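(* Let $\{P_0,\dots,P_m\}$ be a symmetric Clifford system on $\mathbb{R}^{2l}$ with $m>0$ and $l-m-1>0$, and let $M_i$, $N_i$ be as defined in the context. (1) For $0\le i\le m-1$, $M_{i+1}$ fibers over $S^{l-1}$ with fiber $S^{l-i-2}$. (2) For $2\le i\le m$, $N_{i-1}$ fibers over $S^{l-1}$ with fiber $S^{i-1}$.
   Context: A symmetric Clifford system on $\mathbb{R}^{2l}$ is a family $\{P_0,\dots,P_m\}$ of symmetric real $2l\times 2l$ matrices satisfying $P_\alpha P_\beta+P_\beta P_\alpha=2\delta_{\alpha\beta}I_{2l}$. $\langle\cdot,\cdot\rangle$ is the Euclidean inner product and $S^{2l-1}(1)\subset\mathbb{R}^{2l}$ the unit sphere. Define $$M_i=\{x\in S^{2l-1}(1)\mid \langle P_0x,x\rangle=\cdots=\langle P_ix,x\rangle=0\}\quad(0\le i\le m),$$ $$N_i=\{x\in S^{2l-1}(1)\mid \langle P_0x,x\rangle^2+\cdots+\langle P_ix,x\rangle^2=1\}\quad(1\le i\le m),$$ which are smooth submanifolds of $S^{2l-1}(1)$. "Fibers over $B$ with fiber $F$" means: is the total space of a smooth fiber bundle over $B$ with fiber diffeomorphic to $F$. *)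

theory Defs
  imports "HOL-Analysis.Analysis"
begin

text \<open>
  Subsets of Euclidean spaces carry the smooth structure inherited from the ambient space:
  a map defined on an arbitrary subset is smooth if near each point it is the restriction of a
  \<open>C\<^sup>\<infinity>\<close> map defined on an open subset of the ambient space (Milnor's convention).
  For embedded submanifolds this is the usual notion of a smooth map.
\<close>

text \<open>\<open>C\<^sup>n\<close> on an open set: \<open>f\<close> is differentiable and all its directional derivatives
  are \<open>C\<^sup>n\<^sup>-\<^sup>1\<close>. The definition is only meant for open \<open>U\<close>, where \<^const>\<open>frechet_derivative\<close> is
  uniquely determined.\<close>

primrec Cn_on :: "nat \<Rightarrow> 'a::euclidean_space set \<Rightarrow> ('a \<Rightarrow> 'b::euclidean_space) \<Rightarrow> bool" where
  "Cn_on 0 U f \<longleftrightarrow> continuous_on U f"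
| "Cn_on (Suc n) U f \<longleftrightarrow>
     (\<forall>x\<in>U. f differentiable (at x)) \<and>
     (\<forall>v. Cn_on n U (\<lambda>x. frechet_derivative f (at x) v))"

definition smooth_map_on :: "'a::euclidean_space set \<Rightarrow> ('a \<Rightarrow> 'b::euclidean_space) \<Rightarrow> bool" where
  "smooth_map_on A f \<longleftrightarrow>
     (\<forall>x\<in>A. \<exists>U g. open U \<and> x \<in> U \<and> (\<forall>n. Cn_on n U g) \<and> (\<forall>y\<in>A \<inter> U. g y = f y))"

definition diffeomorphism_on ::
    "'a::euclidean_space set \<Rightarrow> 'b::euclidean_space set \<Rightarrow> ('a \<Rightarrow> 'b) \<Rightarrow> bool" where
  "diffeomorphism_on A B f \<longleftrightarrow>
     bij_betw f A B \<and> smooth_map_on A f \<and> smooth_map_on B (inv_into A f)"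

text \<open>The model space \<open>\<real>\<^sup>k\<close> of the charts is realised as a \<open>k\<close>-dimensional linear subspace of
  the ambient space.\<close>

definition smooth_submanifold :: "nat \<Rightarrow> 'a::euclidean_space set \<Rightarrow> bool" where
  "smooth_submanifold k S \<longleftrightarrow>
     (\<forall>x\<in>S. \<exists>U (L :: 'a set) V \<phi>. openin (top_of_set S) U \<and> x \<in> U \<and>
        subspace L \<and> dim L = k \<and> openin (top_of_set L) V \<and> diffeomorphism_on U V \<phi>)"

definition smooth_fiber_bundle ::
    "'a::euclidean_space set \<Rightarrow> 'b::euclidean_space set \<Rightarrow> 'c::euclidean_space set \<Rightarrow> ('a \<Rightarrow> 'b) \<Rightarrow> bool"
where
  "smooth_fiber_bundle E B F \<pi> \<longleftrightarrow>
     (\<exists>k. smooth_submanifold k E) \<and> (\<exists>k. smooth_submanifold k B) \<and> (\<exists>k. smooth_submanifold k F) \<and>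
     smooth_map_on E \<pi> \<and> \<pi> ` E = B \<and>
     (\<forall>b\<in>B. \<exists>U \<phi>. openin (top_of_set B) U \<and> b \<in> U \<and>
        diffeomorphism_on (E \<inter> \<pi> -` U) (U \<times> F) \<phi> \<and>
        (\<forall>x\<in>E \<inter> \<pi> -` U. fst (\<phi> x) = \<pi> x))"

definition fibers_over ::
    "'a::euclidean_space set \<Rightarrow> 'b::euclidean_space set \<Rightarrow> 'c::euclidean_space set \<Rightarrow> bool" where
  "fibers_over E B F \<longleftrightarrow> (\<exists>\<pi>. smooth_fiber_bundle E B F \<pi>)"

text \<open>Only the matrices \<open>P 0, \<dots>, P m\<close> of the sequence \<open>P\<close> are constrained.\<close>

definition symmetric_clifford_system :: "nat \<Rightarrow> (nat \<Rightarrow> real^'n^'n) \<Rightarrow> bool" where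
  "symmetric_clifford_system m P \<longleftrightarrow>
     (\<forall>\<alpha>\<le>m. transpose (P \<alpha>) = P \<alpha>) \<and>
     (\<forall>\<alpha>\<le>m. \<forall>\<beta>\<le>m. P \<alpha> ** P \<beta> + P \<beta> ** P \<alpha> = (2 * of_bool (\<alpha> = \<beta>)) *\<^sub>R mat 1)"

definition clifford_M :: "(nat \<Rightarrow> real^'n^'n) \<Rightarrow> nat \<Rightarrow> (real^'n) set" where
  "clifford_M P i = {x \<in> sphere 0 1. \<forall>\<alpha>\<le>i. (P \<alpha> *v x) \<bullet> x = 0}"

definition clifford_N :: "(nat \<Rightarrow> real^'n^'n) \<Rightarrow> nat \<Rightarrow> (real^'n) set" where
  "clifford_N P i = {x \<in> sphere 0 1. (\<Sum>\<alpha>\<le>i. ((P \<alpha> *v x) \<bullet> x)\<^sup>2) = 1}"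

end

theory Submission
  imports Defs
begin

text \<open>
  Let \<open>Q\<close> be one of the matrices of the system; the others swap its two eigenspaces, which therefore
  have dimension \<open>l\<close>. If \<open>\<langle>Qx, x\<rangle> = 0\<close> then \<open>x = (u + v) / \<surd>2\<close> with unit eigenvectors
  \<open>Qu = u\<close> and \<open>Qv = -v\<close>, and in both cases the projection is \<open>x \<mapsto> u\<close>.

  For \<open>N\<^sub>i\<^sub>-\<^sub>1\<close> take \<open>Q = P\<^sub>i\<close>. Bessel's equality gives \<open>x = \<Sum> c\<^sub>a P\<^sub>a x\<close> with
  \<open>c\<^sub>a = \<langle>P\<^sub>a x, x\<rangle>\<close>, hence \<open>v = \<Sum> c\<^sub>a P\<^sub>a u\<close>: the bundle is trivial, with fibre coordinate \<open>c\<close>.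

  For \<open>M\<^sub>i\<^sub>+\<^sub>1\<close> take \<open>Q = P\<^sub>0\<close>. The remaining equations say that \<open>v\<close> is orthogonal to the orthonormal
  vectors \<open>P\<^sub>1 u, \<dots>, P\<^sub>i\<^sub>+\<^sub>1 u\<close>. Near a given \<open>u\<^sub>0\<close> there is an isometry, depending smoothly on \<open>u\<close>, that
  carries the frame at \<open>u\<^sub>0\<close> to the frame at \<open>u\<close>; it identifies the fibres.
\<close>

section \<open>Smooth maps\<close>

lemma Cn_on_subset: "Cn_on n U f \<Longrightarrow> V \<subseteq> U \<Longrightarrow> Cn_on n V f"
  by (induction n arbitrary: f) (auto intro: continuous_on_subset)

text \<open>Since \<open>U\<close> is open, two functions that agree on \<open>U\<close> agree near
  each of its points and so have the same derivative there. This allows rewriting under the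
  induction over \<open>n\<close>.\<close>

lemma Cn_on_cong:
  assumes "open U" "\<And>x. x \<in> U \<Longrightarrow> f x = g x" "Cn_on n U f"
  shows "Cn_on n U g"
  using assms(2,3)
proof (induction n arbitrary: f g)
  case 0
  then show ?case using continuous_on_cong[of U U f g] by simp
next
  case (Suc n)
  have D: "(g has_derivative frechet_derivative f (at x)) (at x)" if "x \<in> U" for x
    using has_derivative_transform_within_open[OF _ assms(1) that, of f _ UNIV g] Suc.prems that
    by (simp add: frechet_derivative_works)
  then have "frechet_derivative g (at x) = frechet_derivative f (at x)" if "x \<in> U" for x
    using that frechet_derivative_at by metis
  with Suc.prems have "Cn_on n U (\<lambda>x. frechet_derivative g (at x) v)" for v
    by (rule_tac Suc.IH[of "\<lambda>x. frechet_derivative f (at x) v"]) simp_all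
  with D show ?case by (auto simp: differentiable_def)
qed

text \<open>Uniqueness of the derivative lets an explicit \<open>f'\<close> replace
  \<open>frechet_derivative\<close>, so the closure properties below reduce to the usual
  differentiation rules.\<close>

lemma Cn_on_SucI:
  assumes "open U" "\<And>x. x \<in> U \<Longrightarrow> (f has_derivative f' x) (at x)" "\<And>v. Cn_on n U (\<lambda>x. f' x v)"
  shows "Cn_on (Suc n) U f"
proof -
  have "f' x = frechet_derivative f (at x)" if "x \<in> U" for x
    using assms(2)[OF that] by (rule frechet_derivative_at)
  then have "Cn_on n U (\<lambda>x. frechet_derivative f (at x) v)" for v
    using assms(3) by (rule_tac Cn_on_cong[OF assms(1), of "\<lambda>x. f' x v"]) simp_all
  then show ?thesis using assms(2) by (auto simp: differentiable_def)
qed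

lemma Cn_on_SucD:
  assumes "Cn_on (Suc n) U f"
  shows "x \<in> U \<Longrightarrow> (f has_derivative frechet_derivative f (at x)) (at x)"
    and "Cn_on n U (\<lambda>x. frechet_derivative f (at x) v)"
  using assms by (auto simp: frechet_derivative_works)

lemma Cn_on_Suc_imp: "Cn_on (Suc n) U f \<Longrightarrow> Cn_on n U f"
proof (induction n arbitrary: f)
  case 0
  then show ?case
    by (auto intro!: continuous_at_imp_continuous_on differentiable_imp_continuous_within)
next
  case (Suc n)
  then show ?case by simp
qed

lemma Cn_on_const: "open U \<Longrightarrow> Cn_on n U (\<lambda>x. c)"
proof (induction n arbitrary: c)
  case (Suc n)
  then show ?case by (intro Cn_on_SucI[where f' = "\<lambda>x v. 0"]) auto
qed simp

lemma Cn_on_bounded_linear: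
  assumes "open U" "bounded_linear f"
  shows "Cn_on n U f"
proof (cases n)
  case 0
  then show ?thesis using assms by (simp add: linear_continuous_on)
next
  case (Suc k)
  have "Cn_on (Suc k) U f"
    using assms
    by (intro Cn_on_SucI[where f' = "\<lambda>x. f"]) (auto intro: bounded_linear_imp_has_derivative Cn_on_const)
  then show ?thesis using Suc by simp
qed

lemma Cn_on_add:
  assumes "open U" "Cn_on n U f" "Cn_on n U g"
  shows "Cn_on n U (\<lambda>x. f x + g x)"
  using assms(2,3)
proof (induction n arbitrary: f g)
  case 0
  then show ?case by (simp add: continuous_on_add)
next
  case (Suc n)
  note f = Cn_on_SucD[OF Suc.prems(1)] and g = Cn_on_SucD[OF Suc.prems(2)]
  show ?case
    by (rule Cn_on_SucI[OF assms(1) has_derivative_add[OF f(1) g(1)]]) (auto intro: Suc.IH f g)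
qed

lemma Cn_on_sum:
  assumes "open U" "\<And>i. i \<in> I \<Longrightarrow> Cn_on n U (f i)"
  shows "Cn_on n U (\<lambda>x. \<Sum>i\<in>I. f i x)"
  using assms(2)
  by (induction I rule: infinite_finite_induct) (auto intro: Cn_on_const Cn_on_add assms(1))

text \<open>Product rule: each term of the derivative pairs a directional derivative of one factor
  with the other factor itself. The latter is demoted to order \<open>n\<close> by
  \<open>Cn_on_Suc_imp\<close>, after which the induction hypothesis applies.\<close>

lemma Cn_on_bilinear:
  assumes "open U" "bounded_bilinear pr" "Cn_on n U f" "Cn_on n U g"
  shows "Cn_on n U (\<lambda>x. pr (f x) (g x))"
  using assms(3,4)
proof (induction n arbitrary: f g)
  case 0
  then show ?case by (simp add: bounded_bilinear.continuous_on[OF assms(2)])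
next
  case (Suc n)
  note f = Cn_on_SucD[OF Suc.prems(1)] and g = Cn_on_SucD[OF Suc.prems(2)]
  show ?case
    by (rule Cn_on_SucI[OF assms(1) bounded_bilinear.FDERIV[OF assms(2) f(1) g(1)]])
      (auto intro!: Suc.IH f g Cn_on_add assms(1) Suc.prems[THEN Cn_on_Suc_imp])
qed

lemma Cn_on_compose:
  assumes "open U" "open V" "f ` U \<subseteq> V" "Cn_on n U f" "Cn_on n V g"
  shows "Cn_on n U (\<lambda>x. g (f x))"
  using assms(4,5)
proof (induction n arbitrary: g)
  case 0
  then show ?case using assms(3) by (auto intro: continuous_on_compose2)
next
  case (Suc n)
  note f = Cn_on_SucD[OF Suc.prems(1)] and g = Cn_on_SucD[OF Suc.prems(2)]
  \<comment> \<open>The chain rule evaluates the derivative of \<open>g\<close> in the direction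
    \<open>frechet_derivative f (at x) v\<close>, which varies with \<open>x\<close>, whereas
    \<open>Cn_on\<close> speaks of fixed directions only. Expanding that direction in
    \<open>Basis\<close> leaves fixed directions with scalar coefficients.\<close>
  define D where "D x v =
    (\<Sum>b\<in>Basis. (frechet_derivative f (at x) v \<bullet> b) *\<^sub>R frechet_derivative g (at (f x)) b)" for x v
  have D: "((\<lambda>x. g (f x)) has_derivative D x) (at x)" if "x \<in> U" for x
  proof -
    have fx: "f x \<in> V" using assms(3) that by auto
    have lin: "linear (frechet_derivative g (at (f x)))"
      using g(1)[OF fx] by (rule has_derivative_linear)
    have *: "frechet_derivative g (at (f x)) w
        = (\<Sum>b\<in>Basis. (w \<bullet> b) *\<^sub>R frechet_derivative g (at (f x)) b)" for w
      by (subst euclidean_representation[of w, symmetric])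
        (simp add: linear_sum[OF lin] linear_scale[OF lin])
    have "D x = (\<lambda>v. frechet_derivative g (at (f x)) (frechet_derivative f (at x) v))"
      by (intro ext) (simp only: D_def *[symmetric])
    then show ?thesis
      using has_derivative_compose[OF f(1)[OF that] g(1)[OF fx]] by simp
  qed
  have inner: "Cn_on n U (\<lambda>x. frechet_derivative f (at x) v \<bullet> b)" for v b
    by (rule Cn_on_bilinear[OF assms(1) bounded_bilinear_inner f(2) Cn_on_const[OF assms(1)]])
  have "Cn_on n U (\<lambda>x. frechet_derivative g (at (f x)) b)" for b
    by (rule Suc.IH[OF Cn_on_Suc_imp[OF Suc.prems(1)] g(2)])
  then have "Cn_on n U (\<lambda>x. D x v)" for v
    unfolding D_def
    by (intro Cn_on_sum assms(1) Cn_on_bilinear[OF assms(1) bounded_bilinear_scaleR] inner)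
  with D show ?case by (rule Cn_on_SucI[OF assms(1)])
qed

text \<open>The derivative of \<open>inverse\<close> is a product of constants and copies of
  \<open>inverse\<close>, so the induction feeds on itself.\<close>

lemma Cn_on_inverse: "Cn_on n (- {0}) (inverse :: real \<Rightarrow> real)"
proof (induction n)
  case 0
  show ?case by (auto intro: continuous_on_inverse)
next
  case (Suc n)
  have op: "open (- {0 :: real})" by auto
  note bil = Cn_on_bilinear[OF op bounded_bilinear_mult]
  have "Cn_on n (- {0}) (\<lambda>x. (-1) * ((inverse x * v) * inverse x :: real))" for v
    by (intro bil Suc.IH Cn_on_const op)
  moreover have "(inverse has_derivative (\<lambda>v. (-1) * ((inverse x * v) * inverse x))) (at x)"
    if "x \<in> - {0}" for x :: real
    using has_derivative_inverse'[of x UNIV] that by simp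
  ultimately show ?case by (intro Cn_on_SucI op)
qed

section \<open>Smooth maps on arbitrary subsets\<close>

lemma smooth_map_onI:
  assumes "open U" "A \<subseteq> U" "\<And>n. Cn_on n U f"
  shows "smooth_map_on A f"
  unfolding smooth_map_on_def using assms by blast

lemma smooth_map_onE:
  assumes "smooth_map_on A f" "x \<in> A"
  obtains U g where "open U" "x \<in> U" "\<And>n. Cn_on n U g" "\<And>y. y \<in> A \<Longrightarrow> y \<in> U \<Longrightarrow> g y = f y"
proof -
  have "\<exists>U g. open U \<and> x \<in> U \<and> (\<forall>n. Cn_on n U g) \<and> (\<forall>y\<in>A \<inter> U. g y = f y)"
    using assms unfolding smooth_map_on_def by (rule bspec)
  then obtain U g where "open U" "x \<in> U" "\<forall>n. Cn_on n U g" "\<forall>y\<in>A \<inter> U. g y = f y" by blast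
  then show ?thesis by (intro that[of U g]) auto
qed

lemma smooth_map_on_subset:
  assumes "smooth_map_on A f" "B \<subseteq> A"
  shows "smooth_map_on B f"
  unfolding smooth_map_on_def
proof
  fix x assume "x \<in> B"
  then have "x \<in> A" using assms(2) by auto
  from smooth_map_onE[OF assms(1) this] obtain U g where "open U" "x \<in> U" "\<And>n. Cn_on n U g"
    "\<And>y. y \<in> A \<Longrightarrow> y \<in> U \<Longrightarrow> g y = f y" by blast
  then show "\<exists>U g. open U \<and> x \<in> U \<and> (\<forall>n. Cn_on n U g) \<and> (\<forall>y\<in>B \<inter> U. g y = f y)"
    using assms(2) by (intro exI[of _ U] exI[of _ g]) auto
qed

lemma smooth_map_on_cong:
  "(\<And>x. x \<in> A \<Longrightarrow> f x = g x) \<Longrightarrow> smooth_map_on A f \<longleftrightarrow> smooth_map_on A g"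
  unfolding smooth_map_on_def by simp

text \<open>Near each point of \<open>A\<close> the map coincides on \<open>A\<close> with a
  continuous extension. Continuity is what makes preimages of chart domains relatively open later
  on.\<close>

lemma smooth_map_on_imp_continuous_on:
  assumes "smooth_map_on A f"
  shows "continuous_on A f"
  unfolding continuous_on_eq_continuous_within
proof
  fix x assume x: "x \<in> A"
  obtain U g where U: "open U" "x \<in> U" "\<And>n. Cn_on n U g" "\<And>y. y \<in> A \<Longrightarrow> y \<in> U \<Longrightarrow> g y = f y"
    using smooth_map_onE[OF assms x] by blast
  have "continuous (at x within A) g"
    using U(1,2) U(3)[of 0] by (auto simp: continuous_on_eq_continuous_at intro: continuous_at_imp_continuous_at_within)
  moreover have "\<forall>\<^sub>F y in at x within A. g y = f y"
    using U by (auto simp: eventually_at_topological)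
  ultimately show "continuous (at x within A) f"
    using U(2) U(4)[OF x] unfolding continuous_within by (metis Lim_transform_eventually)
qed

lemma smooth_map_on_compose:
  assumes "smooth_map_on A f" "smooth_map_on B g" "f ` A \<subseteq> B"
  shows "smooth_map_on A (\<lambda>x. g (f x))"
  unfolding smooth_map_on_def
proof
  fix x assume x: "x \<in> A"
  obtain U f' where U: "open U" "x \<in> U" "\<And>n. Cn_on n U f'" "\<And>y. y \<in> A \<Longrightarrow> y \<in> U \<Longrightarrow> f' y = f y"
    using smooth_map_onE[OF assms(1) x] by blast
  obtain V g' where V: "open V" "f x \<in> V" "\<And>n. Cn_on n V g'" "\<And>y. y \<in> B \<Longrightarrow> y \<in> V \<Longrightarrow> g' y = g y"
    using smooth_map_onE[OF assms(2)] x assms(3) by blast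
  \<comment> \<open>The extension \<open>f'\<close> may leave \<open>V\<close> away from
    \<open>A\<close>, so its domain is cut down before composing.\<close>
  define W where "W = U \<inter> f' -` V"
  have W: "open W"
    unfolding W_def using U(3)[of 0] by (intro continuous_open_preimage U V) simp_all
  have "Cn_on n W (\<lambda>x. g' (f' x))" for n
    by (rule Cn_on_compose[OF W V(1) _ Cn_on_subset[OF U(3)] V(3)]) (auto simp: W_def)
  moreover have "x \<in> W" using x U V by (auto simp: W_def)
  moreover have "\<forall>y\<in>A \<inter> W. g' (f' y) = g (f y)"
    using U(4) V(4) assms(3) unfolding W_def by fastforce
  ultimately show "\<exists>U h. open U \<and> x \<in> U \<and> (\<forall>n. Cn_on n U h) \<and> (\<forall>y\<in>A \<inter> U. h y = g (f y))"
    using W by (intro exI[of _ W] exI[of _ "\<lambda>x. g' (f' x)"]) auto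
qed

lemma smooth_map_on_Pair:
  assumes "smooth_map_on A f" "smooth_map_on A g"
  shows "smooth_map_on A (\<lambda>x. (f x, g x))"
  unfolding smooth_map_on_def
proof
  fix x assume x: "x \<in> A"
  obtain U f' where U: "open U" "x \<in> U" "\<And>n. Cn_on n U f'" "\<And>y. y \<in> A \<Longrightarrow> y \<in> U \<Longrightarrow> f' y = f y"
    using smooth_map_onE[OF assms(1) x] by blast
  obtain V g' where V: "open V" "x \<in> V" "\<And>n. Cn_on n V g'" "\<And>y. y \<in> A \<Longrightarrow> y \<in> V \<Longrightarrow> g' y = g y"
    using smooth_map_onE[OF assms(2) x] by blast
  have op: "open (U \<inter> V)" using U V by auto
  \<comment> \<open>The pair is a sum of two linear embeddings into the product, which reduces
    pairing to addition and composition.\<close>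
  have "Cn_on n (U \<inter> V) (\<lambda>x. (f' x, 0) + (0, g' x))" for n
  proof (rule Cn_on_add[OF op])
    show "Cn_on n (U \<inter> V) (\<lambda>x. (f' x, 0 :: 'c))"
      by (rule Cn_on_compose[OF op open_UNIV _ Cn_on_subset[OF U(3)], where g = "\<lambda>y. (y, 0)"])
        (auto intro!: Cn_on_bounded_linear bounded_linear_intros)
    show "Cn_on n (U \<inter> V) (\<lambda>x. (0 :: 'b, g' x))"
      by (rule Cn_on_compose[OF op open_UNIV _ Cn_on_subset[OF V(3)], where g = "\<lambda>y. (0, y)"])
        (auto intro!: Cn_on_bounded_linear bounded_linear_intros)
  qed
  then show "\<exists>U h. open U \<and> x \<in> U \<and> (\<forall>n. Cn_on n U h) \<and> (\<forall>y\<in>A \<inter> U. h y = (f y, g y))"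
    using op U V by (intro exI[of _ "U \<inter> V"] exI[of _ "\<lambda>x. (f' x, g' x)"]) auto
qed

lemma smooth_map_on_bounded_linear: "bounded_linear f \<Longrightarrow> smooth_map_on A f"
  by (rule smooth_map_onI[of UNIV]) (auto intro: Cn_on_bounded_linear)

lemma smooth_map_on_linear: "linear f \<Longrightarrow> smooth_map_on A f"
  by (simp add: smooth_map_on_bounded_linear linear_conv_bounded_linear)

lemma smooth_map_on_const: "smooth_map_on A (\<lambda>x. c)"
  by (rule smooth_map_onI[of UNIV]) (auto intro: Cn_on_const)

lemma smooth_map_on_ident: "smooth_map_on A (\<lambda>x. x)"
  by (rule smooth_map_on_bounded_linear[OF bounded_linear_ident])

lemma smooth_map_on_compose_linear:
  "linear g \<Longrightarrow> smooth_map_on A f \<Longrightarrow> smooth_map_on A (\<lambda>x. g (f x))"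
  using smooth_map_on_compose[OF _ smooth_map_on_linear[of g UNIV], of A f] by simp

lemma smooth_map_on_fst: "smooth_map_on A f \<Longrightarrow> smooth_map_on A (\<lambda>x. fst (f x))"
  by (rule smooth_map_on_compose_linear[OF linear_fst])

lemma smooth_map_on_snd: "smooth_map_on A f \<Longrightarrow> smooth_map_on A (\<lambda>x. snd (f x))"
  by (rule smooth_map_on_compose_linear[OF linear_snd])

lemma smooth_map_on_bilinear:
  assumes "bounded_bilinear pr" "smooth_map_on A f" "smooth_map_on A g"
  shows "smooth_map_on A (\<lambda>x. pr (f x) (g x))"
proof -
  have "Cn_on n UNIV (\<lambda>p. pr (fst p) (snd p))" for n
    by (intro Cn_on_bilinear[OF open_UNIV assms(1)] Cn_on_bounded_linear
        bounded_linear_fst bounded_linear_snd open_UNIV)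
  then have "smooth_map_on UNIV (\<lambda>p. pr (fst p) (snd p))"
    by (intro smooth_map_onI[of UNIV]) auto
  from smooth_map_on_compose[OF smooth_map_on_Pair[OF assms(2,3)] this] show ?thesis by simp
qed

lemma smooth_map_on_add:
  assumes "smooth_map_on A f" "smooth_map_on A g"
  shows "smooth_map_on A (\<lambda>x. f x + g x)"
proof -
  have "linear (\<lambda>p :: 'b \<times> 'b. fst p + snd p)"
    by (simp add: linear_iff algebra_simps)
  from smooth_map_on_compose_linear[OF this smooth_map_on_Pair[OF assms]] show ?thesis by simp
qed

lemmas smooth_map_on_scaleR = smooth_map_on_bilinear[OF bounded_bilinear_scaleR]
lemmas smooth_map_on_mult = smooth_map_on_bilinear[OF bounded_bilinear_mult]
lemmas smooth_map_on_inner = smooth_map_on_bilinear[OF bounded_bilinear_inner]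

lemma smooth_map_on_diff:
  assumes "smooth_map_on A f" "smooth_map_on A g"
  shows "smooth_map_on A (\<lambda>x. f x - g x)"
  using smooth_map_on_add[OF assms(1) smooth_map_on_scaleR[OF smooth_map_on_const[of A "-1"] assms(2)]]
  by simp

lemma smooth_map_on_sum:
  "(\<And>i. i \<in> I \<Longrightarrow> smooth_map_on A (f i)) \<Longrightarrow> smooth_map_on A (\<lambda>x. \<Sum>i\<in>I. f i x)"
  by (induction I rule: infinite_finite_induct) (auto intro: smooth_map_on_const smooth_map_on_add)

lemma smooth_map_on_divide:
  fixes f g :: "'a::euclidean_space \<Rightarrow> real"
  assumes "smooth_map_on A f" "smooth_map_on A g" "\<And>x. x \<in> A \<Longrightarrow> g x \<noteq> 0"
  shows "smooth_map_on A (\<lambda>x. f x / g x)"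
proof -
  have "smooth_map_on (- {0}) (inverse :: real \<Rightarrow> real)"
    by (rule smooth_map_onI[of "- {0}"]) (auto intro: Cn_on_inverse)
  moreover have "g ` A \<subseteq> - {0}" using assms(3) by auto
  ultimately have "smooth_map_on A (\<lambda>x. inverse (g x))"
    by (rule smooth_map_on_compose[OF assms(2)])
  from smooth_map_on_mult[OF assms(1) this] show ?thesis by (simp add: divide_inverse)
qed

lemmas smooth_map_on_intros =
  smooth_map_on_const smooth_map_on_ident smooth_map_on_Pair smooth_map_on_fst smooth_map_on_snd
  smooth_map_on_add smooth_map_on_diff smooth_map_on_sum smooth_map_on_scaleR smooth_map_on_mult
  smooth_map_on_inner smooth_map_on_divide

text \<open>A two-sided inverse \<open>g\<close> agrees on \<open>B\<close> with the
  \<open>inv_into A f\<close> of the definition, so its smoothness carries over.\<close>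

lemma diffeomorphism_onI:
  assumes "smooth_map_on A f" "smooth_map_on B g" "f ` A \<subseteq> B" "g ` B \<subseteq> A"
    "\<And>x. x \<in> A \<Longrightarrow> g (f x) = x" "\<And>y. y \<in> B \<Longrightarrow> f (g y) = y"
  shows "diffeomorphism_on A B f"
proof -
  have bij: "bij_betw f A B"
    by (rule bij_betw_byWitness[of A g]) (use assms in auto)
  have "inv_into A f y = g y" if "y \<in> B" for y
    using that assms bij by (intro inv_into_f_eq) (auto simp: bij_betw_def)
  then have "smooth_map_on B (inv_into A f)"
    using assms(2) smooth_map_on_cong[of B "inv_into A f" g] by simp
  with bij assms(1) show ?thesis by (simp add: diffeomorphism_on_def)
qed

lemma diffeomorphism_onE:
  assumes "diffeomorphism_on A B f"
  obtains g where "smooth_map_on A f" "smooth_map_on B g" "f ` A \<subseteq> B" "g ` B \<subseteq> A"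
    "\<And>x. x \<in> A \<Longrightarrow> g (f x) = x" "\<And>y. y \<in> B \<Longrightarrow> f (g y) = y"
  using assms unfolding diffeomorphism_on_def
  by (intro that[of "inv_into A f"]) (auto simp: bij_betw_def intro: f_inv_into_f inv_into_into)

section \<open>Submanifolds and fiber bundles\<close>

text \<open>The chart \<open>\<phi>\<close> around \<open>p\<close> is stereographic projection from
  the antipode \<open>-p\<close> onto the hyperplane orthogonal to \<open>p\<close>;
  \<open>\<psi>\<close> is its inverse. On the sphere the condition
  \<open>0 < 1 + x \<bullet> p\<close> removes just the point \<open>-p\<close>.\<close>

lemma smooth_submanifold_sphere:
  "smooth_submanifold (DIM('a) - 1) (sphere 0 1 :: 'a::euclidean_space set)"
  unfolding smooth_submanifold_def
proof
  fix p :: 'a assume "p \<in> sphere 0 1"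
  then have pp: "p \<bullet> p = 1" by (simp add: dot_square_norm)
  define L where "L = {x. p \<bullet> x = 0}"
  define U where "U = sphere 0 1 \<inter> {x. 0 < 1 + x \<bullet> p}"
  define \<phi> where "\<phi> x = (1 / (1 + x \<bullet> p)) *\<^sub>R (x - (x \<bullet> p) *\<^sub>R p)" for x
  define \<psi> where "\<psi> y = (1 / (1 + y \<bullet> y)) *\<^sub>R (2 *\<^sub>R y + (1 - y \<bullet> y) *\<^sub>R p)" for y
  have pos: "1 + y \<bullet> y > 0" for y :: 'a
    by (smt (verit) inner_ge_zero)
  have "p \<noteq> 0" using pp by auto
  have \<phi>: "\<phi> x \<bullet> p = 0" "\<phi> x \<bullet> \<phi> x = (1 - x \<bullet> p) / (1 + x \<bullet> p)"
     "\<psi> (\<phi> x) = x" if "x \<in> U" for x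
  proof -
    have xx: "x \<bullet> x = 1" and c: "0 < 1 + x \<bullet> p" using that by (auto simp: U_def dot_square_norm)
    show "\<phi> x \<bullet> p = 0"
      by (simp add: \<phi>_def inner_diff_left pp)
    have "\<phi> x \<bullet> \<phi> x = (1 / (1 + x \<bullet> p))\<^sup>2 * (1 - (x \<bullet> p)\<^sup>2)"
      by (simp add: \<phi>_def inner_diff_left inner_diff_right pp xx power2_eq_square inner_commute)
    also have "\<dots> = (1 - x \<bullet> p) / (1 + x \<bullet> p)"
      using c by (simp add: power2_eq_square divide_simps) (simp add: algebra_simps)
    finally show *: "\<phi> x \<bullet> \<phi> x = (1 - x \<bullet> p) / (1 + x \<bullet> p)" .
    have "1 + \<phi> x \<bullet> \<phi> x = 2 / (1 + x \<bullet> p)"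
      using c unfolding * by (simp add: field_simps)
    moreover have "1 - \<phi> x \<bullet> \<phi> x = 2 * (x \<bullet> p) / (1 + x \<bullet> p)"
      using c unfolding * by (simp add: field_simps)
    ultimately have "\<psi> (\<phi> x) = ((1 + x \<bullet> p) / 2) *\<^sub>R
       (2 *\<^sub>R (1 / (1 + x \<bullet> p)) *\<^sub>R (x - (x \<bullet> p) *\<^sub>R p) + (2 * (x \<bullet> p) / (1 + x \<bullet> p)) *\<^sub>R p)"
      unfolding \<psi>_def by (simp add: \<phi>_def)
    also have "\<dots> = x"
      using c by (simp add: algebra_simps)
    finally show "\<psi> (\<phi> x) = x" .
  qed
  have \<psi>: "\<psi> y \<in> U" "\<phi> (\<psi> y) = y" if "y \<in> L" for y
  proof -
    have yp: "y \<bullet> p = 0" "p \<bullet> y = 0" using that by (auto simp: L_def inner_commute)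
    have "\<psi> y \<bullet> \<psi> y = (1 / (1 + y \<bullet> y))\<^sup>2 * (4 * (y \<bullet> y) + (1 - y \<bullet> y)\<^sup>2)"
      by (simp add: \<psi>_def inner_add_left inner_add_right yp pp power2_eq_square add_divide_distrib)
    also have "4 * (y \<bullet> y) + (1 - y \<bullet> y)\<^sup>2 = (1 + y \<bullet> y)\<^sup>2"
      by (simp add: power2_eq_square algebra_simps)
    finally have n: "\<psi> y \<bullet> \<psi> y = 1"
      using pos[of y] by (simp add: power_divide)
    have c': "\<psi> y \<bullet> p = (1 - y \<bullet> y) / (1 + y \<bullet> y)"
      by (simp add: \<psi>_def inner_add_left yp pp)
    have c: "1 + \<psi> y \<bullet> p = 2 / (1 + y \<bullet> y)"
      unfolding c' using pos[of y] by (simp add: field_simps)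
    show "\<psi> y \<in> U"
      using n c pos[of y] by (simp add: U_def norm_eq_1)
    have e: "1 / 2 * r * (s / r) = 1 / 2 * s" "1 / (2 / r) = 1 / 2 * r" if "r > 0" for r s :: real
      using that by auto
    have "\<phi> (\<psi> y) = (1 / 2) *\<^sub>R ((1 + y \<bullet> y) *\<^sub>R \<psi> y - (1 - y \<bullet> y) *\<^sub>R p)"
      unfolding \<phi>_def c unfolding c' scaleR_diff_right scaleR_scaleR e[OF pos] ..
    also have "(1 + y \<bullet> y) *\<^sub>R \<psi> y = 2 *\<^sub>R y + (1 - y \<bullet> y) *\<^sub>R p"
      using pos[of y] by (simp add: \<psi>_def del: scaleR_add_right scaleR_add_left)
    finally show "\<phi> (\<psi> y) = y" by simp
  qed
  have "diffeomorphism_on U L \<phi>"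
  proof (rule diffeomorphism_onI)
    show "smooth_map_on U \<phi>"
      unfolding \<phi>_def by (intro smooth_map_on_intros) (auto simp: U_def)
    show "smooth_map_on L \<psi>"
      unfolding \<psi>_def by (intro smooth_map_on_intros) (use pos in \<open>auto simp: less_le\<close>)
  qed (use \<phi> \<psi> in \<open>auto simp: L_def inner_commute\<close>)
  moreover have "openin (top_of_set (sphere 0 1)) U"
    unfolding U_def by (intro openin_open_Int open_Collect_less continuous_intros)
  moreover have "p \<in> U" using pp by (simp add: U_def norm_eq_1)
  moreover have "subspace L" "dim L = DIM('a) - 1"
    using \<open>p \<noteq> 0\<close> by (simp_all add: L_def subspace_hyperplane dim_hyperplane)
  ultimately show "\<exists>U (L :: 'a set) V \<phi>. openin (top_of_set (sphere 0 1)) U \<and> p \<in> U \<and> subspace L \<and>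
      dim L = DIM('a) - 1 \<and> openin (top_of_set L) V \<and> diffeomorphism_on U V \<phi>"
    by (blast intro: openin_subtopology_self)
qed

text \<open>A chart can be shrunk into any relatively open neighbourhood \<open>W\<close>: its range
  becomes the preimage of \<open>U \<inter> W\<close> under the inverse chart, which is again
  relatively open.\<close>

lemma submanifold_chartE:
  fixes S :: "'a::euclidean_space set"
  assumes "smooth_submanifold k S" "x \<in> S" "openin (top_of_set S) W" "x \<in> W"
  obtains U and L :: "'a set" and V \<phi> \<psi> where
    "openin (top_of_set S) U" "x \<in> U" "U \<subseteq> W" "subspace L" "dim L = k" "openin (top_of_set L) V"
    "smooth_map_on U \<phi>" "smooth_map_on V \<psi>" "\<phi> ` U \<subseteq> V" "\<psi> ` V \<subseteq> U"
    "\<And>y. y \<in> U \<Longrightarrow> \<psi> (\<phi> y) = y" "\<And>y. y \<in> V \<Longrightarrow> \<phi> (\<psi> y) = y"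
proof -
  have "\<exists>U (L :: 'a set) V \<phi>. openin (top_of_set S) U \<and> x \<in> U \<and>
        subspace L \<and> dim L = k \<and> openin (top_of_set L) V \<and> diffeomorphism_on U V \<phi>"
    using assms(1,2) unfolding smooth_submanifold_def by (rule bspec)
  then obtain U and L :: "'a set" and V \<phi> where U: "openin (top_of_set S) U" "x \<in> U"
    and L: "subspace L" "dim L = k" "openin (top_of_set L) V" and d: "diffeomorphism_on U V \<phi>"
    by blast
  from d obtain \<psi> where \<psi>: "smooth_map_on U \<phi>" "smooth_map_on V \<psi>" "\<phi> ` U \<subseteq> V" "\<psi> ` V \<subseteq> U"
    "\<And>y. y \<in> U \<Longrightarrow> \<psi> (\<phi> y) = y" "\<And>y. y \<in> V \<Longrightarrow> \<phi> (\<psi> y) = y"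
    by (rule diffeomorphism_onE) blast
  define V' where "V' = V \<inter> \<psi> -` (U \<inter> W)"
  have "openin (top_of_set U) (U \<inter> W)"
    using openin_subset_trans[OF openin_Int[OF U(1) assms(3)] _ openin_imp_subset[OF U(1)]] by simp
  then have "openin (top_of_set V) V'"
    unfolding V'_def using \<psi>(4) smooth_map_on_imp_continuous_on[OF \<psi>(2)]
    by (intro continuous_openin_preimage) auto
  then have V': "openin (top_of_set L) V'"
    using L(3) openin_trans by blast
  show ?thesis
  proof (rule that[of "U \<inter> W" L V' \<phi> \<psi>])
    show "openin (top_of_set S) (U \<inter> W)" using U(1) assms(3) by (rule openin_Int)
    show "smooth_map_on (U \<inter> W) \<phi>" "smooth_map_on V' \<psi>"
      using \<psi>(1,2) by (auto intro: smooth_map_on_subset simp: V'_def)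
    show "\<phi> ` (U \<inter> W) \<subseteq> V'" using \<psi>(3,5) by (auto simp: V'_def)
  qed (use U L V' assms \<psi> in \<open>auto simp: V'_def\<close>)
qed

text \<open>Charts of \<open>N\<close> are pulled back along the local diffeomorphisms. Their model
  spaces lie in \<open>'b\<close>, while the definition asks for a subspace of \<open>'a\<close>;
  the bound \<open>k \<le> DIM('a)\<close> provides one of the right dimension, and a linear
  isomorphism moves the chart there.\<close>

lemma smooth_submanifold_locally_diffeomorphic:
  fixes S :: "'a::euclidean_space set" and N :: "'b::euclidean_space set"
  assumes N: "smooth_submanifold k N" and k: "k \<le> DIM('a)"
    and loc: "\<And>x. x \<in> S \<Longrightarrow> \<exists>W W' \<phi>. openin (top_of_set S) W \<and> x \<in> W \<and>
      openin (top_of_set N) W' \<and> diffeomorphism_on W W' \<phi>"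
  shows "smooth_submanifold k S"
  unfolding smooth_submanifold_def
proof
  fix x assume "x \<in> S"
  from loc[OF this] obtain W W' \<phi> where W: "openin (top_of_set S) W" "x \<in> W"
    and W': "openin (top_of_set N) W'" and d: "diffeomorphism_on W W' \<phi>" by blast
  from d obtain \<psi> where \<psi>: "smooth_map_on W \<phi>" "smooth_map_on W' \<psi>" "\<phi> ` W \<subseteq> W'" "\<psi> ` W' \<subseteq> W"
    "\<And>y. y \<in> W \<Longrightarrow> \<psi> (\<phi> y) = y" "\<And>y. y \<in> W' \<Longrightarrow> \<phi> (\<psi> y) = y"
    by (rule diffeomorphism_onE) blast
  have "\<phi> x \<in> W'" using \<psi>(3) W(2) by auto
  moreover then have "\<phi> x \<in> N" using openin_imp_subset[OF W'] by auto
  ultimately obtain U and L :: "'b set" and V \<xi> \<xi>' where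
    U: "openin (top_of_set N) U" "\<phi> x \<in> U" "U \<subseteq> W'"
    and L: "subspace L" "dim L = k" "openin (top_of_set L) V"
    and \<xi>: "smooth_map_on U \<xi>" "smooth_map_on V \<xi>'" "\<xi> ` U \<subseteq> V" "\<xi>' ` V \<subseteq> U"
    "\<And>y. y \<in> U \<Longrightarrow> \<xi>' (\<xi> y) = y" "\<And>y. y \<in> V \<Longrightarrow> \<xi> (\<xi>' y) = y"
    using submanifold_chartE[OF N _ W'] by blast
  obtain L' :: "'a set" where L': "subspace L'" "dim L' = k"
    using choose_subspace_of_subspace[of k "UNIV :: 'a set"] k by auto
  obtain f g where fg: "linear f" "linear g" "f ` L = L'" "g ` L' = L"
    "\<And>x. x \<in> L \<Longrightarrow> g (f x) = x" "\<And>x. x \<in> L' \<Longrightarrow> f (g x) = x"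
    using isometries_subspaces[OF L(1) L'(1)] L(2) L'(2) by metis
  have VL: "V \<subseteq> L" using openin_imp_subset[OF L(3)] .
  define D where "D = W \<inter> \<phi> -` U"
  define V' where "V' = L' \<inter> g -` V"
  have "openin (top_of_set W') U"
    using U(1,3) openin_imp_subset[OF W'] openin_subset_trans by blast
  then have "openin (top_of_set W) D"
    unfolding D_def using \<psi>(3) smooth_map_on_imp_continuous_on[OF \<psi>(1)]
    by (intro continuous_openin_preimage) auto
  then have "openin (top_of_set S) D" using W(1) openin_trans by blast
  moreover have "openin (top_of_set L') V'"
    unfolding V'_def using fg(4) L(3) linear_continuous_on[of g L'] fg(2)
    by (intro continuous_openin_preimage) (auto simp: linear_conv_bounded_linear)
  moreover have "diffeomorphism_on D V' (\<lambda>y. f (\<xi> (\<phi> y)))"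
  proof (rule diffeomorphism_onI[where g = "\<lambda>y. \<psi> (\<xi>' (g y))"])
    have "smooth_map_on D \<phi>" using \<psi>(1) by (rule smooth_map_on_subset) (auto simp: D_def)
    then have "smooth_map_on D (\<lambda>y. \<xi> (\<phi> y))"
      using \<xi>(1) by (rule smooth_map_on_compose) (auto simp: D_def)
    then show "smooth_map_on D (\<lambda>y. f (\<xi> (\<phi> y)))"
      by (rule smooth_map_on_compose_linear[OF fg(1)])
    have "smooth_map_on V' (\<lambda>y. \<xi>' (g y))"
      using smooth_map_on_linear[OF fg(2)] \<xi>(2) by (rule smooth_map_on_compose) (auto simp: V'_def)
    then show "smooth_map_on V' (\<lambda>y. \<psi> (\<xi>' (g y)))"
      using \<psi>(2) by (rule smooth_map_on_compose) (use \<xi>(4) U(3) in \<open>auto simp: V'_def\<close>)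
    show "(\<lambda>y. f (\<xi> (\<phi> y))) ` D \<subseteq> V'"
    proof safe
      fix y assume "y \<in> D"
      then have "\<xi> (\<phi> y) \<in> V" using \<xi>(3) by (auto simp: D_def)
      then show "f (\<xi> (\<phi> y)) \<in> V'" using VL fg(3,5) by (auto simp: V'_def)
    qed
    show "(\<lambda>y. \<psi> (\<xi>' (g y))) ` V' \<subseteq> D"
    proof safe
      fix y assume "y \<in> V'"
      then have "\<xi>' (g y) \<in> U" using \<xi>(4) by (auto simp: V'_def)
      then show "\<psi> (\<xi>' (g y)) \<in> D" using U(3) \<psi>(4,6) by (auto simp: D_def)
    qed
    show "\<psi> (\<xi>' (g (f (\<xi> (\<phi> y))))) = y" if "y \<in> D" for y
    proof -
      have "\<xi> (\<phi> y) \<in> L" using that \<xi>(3) VL by (auto simp: D_def)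
      then show ?thesis using that fg(5) \<xi>(5) \<psi>(5) by (simp add: D_def)
    qed
    show "f (\<xi> (\<phi> (\<psi> (\<xi>' (g y))))) = y" if "y \<in> V'" for y
    proof -
      have "\<xi>' (g y) \<in> W'" using that \<xi>(4) U(3) by (auto simp: V'_def)
      then show ?thesis using that fg(6) \<xi>(6) \<psi>(6) by (simp add: V'_def)
    qed
  qed
  moreover have "x \<in> D" using W U by (auto simp: D_def)
  ultimately show "\<exists>U (L :: 'a set) V \<phi>. openin (top_of_set S) U \<and> x \<in> U \<and> subspace L \<and>
      dim L = k \<and> openin (top_of_set L) V \<and> diffeomorphism_on U V \<phi>"
    using L' by blast
qed

lemma smooth_submanifold_Times:
  fixes S :: "'a::euclidean_space set" and T :: "'b::euclidean_space set"
  assumes S: "smooth_submanifold k S" and T: "smooth_submanifold l T"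
  shows "smooth_submanifold (k + l) (S \<times> T)"
  unfolding smooth_submanifold_def
proof
  fix z assume "z \<in> S \<times> T"
  then have x: "fst z \<in> S" and y: "snd z \<in> T" by auto
  obtain U1 and L1 :: "'a set" and V1 \<phi>1 \<psi>1 where
    1: "openin (top_of_set S) U1" "fst z \<in> U1" "subspace L1" "dim L1 = k" "openin (top_of_set L1) V1"
    "smooth_map_on U1 \<phi>1" "smooth_map_on V1 \<psi>1" "\<phi>1 ` U1 \<subseteq> V1" "\<psi>1 ` V1 \<subseteq> U1"
    "\<And>y. y \<in> U1 \<Longrightarrow> \<psi>1 (\<phi>1 y) = y" "\<And>y. y \<in> V1 \<Longrightarrow> \<phi>1 (\<psi>1 y) = y"
    by (rule submanifold_chartE[OF S x openin_subtopology_self x]) (rule that, assumption+)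
  obtain U2 and L2 :: "'b set" and V2 \<phi>2 \<psi>2 where
    2: "openin (top_of_set T) U2" "snd z \<in> U2" "subspace L2" "dim L2 = l" "openin (top_of_set L2) V2"
    "smooth_map_on U2 \<phi>2" "smooth_map_on V2 \<psi>2" "\<phi>2 ` U2 \<subseteq> V2" "\<psi>2 ` V2 \<subseteq> U2"
    "\<And>y. y \<in> U2 \<Longrightarrow> \<psi>2 (\<phi>2 y) = y" "\<And>y. y \<in> V2 \<Longrightarrow> \<phi>2 (\<psi>2 y) = y"
    by (rule submanifold_chartE[OF T y openin_subtopology_self y]) (rule that, assumption+)
  have prod: "smooth_map_on (C \<times> D) (\<lambda>p. (f (fst p), g (snd p)))"
    if "smooth_map_on C f" "smooth_map_on D g"
    for C D and f :: "'a \<Rightarrow> 'a" and g :: "'b \<Rightarrow> 'b"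
    by (intro smooth_map_on_Pair smooth_map_on_compose[OF _ that(1)] smooth_map_on_compose[OF _ that(2)]
        smooth_map_on_intros) auto
  have "diffeomorphism_on (U1 \<times> U2) (V1 \<times> V2) (\<lambda>p. (\<phi>1 (fst p), \<phi>2 (snd p)))"
    by (rule diffeomorphism_onI[OF prod prod[of _ \<psi>1 _ \<psi>2]]) (use 1 2 in auto)
  moreover have "z \<in> U1 \<times> U2" using 1 2 by (cases z) auto
  moreover have "openin (top_of_set (S \<times> T)) (U1 \<times> U2)" "openin (top_of_set (L1 \<times> L2)) (V1 \<times> V2)"
    using 1 2 by (auto intro: openin_Times)
  moreover have "subspace (L1 \<times> L2)" using 1 2 by (auto intro: subspace_Times)
  moreover have "dim (L1 \<times> L2) = k + l" using 1 2 by (simp add: dim_Times)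
  ultimately show "\<exists>U (L :: ('a \<times> 'b) set) V \<phi>. openin (top_of_set (S \<times> T)) U \<and> z \<in> U \<and> subspace L \<and>
      dim L = k + l \<and> openin (top_of_set L) V \<and> diffeomorphism_on U V \<phi>"
    by blast
qed

text \<open>A local trivialisation is given by its fibre coordinate \<open>h\<close> and its inverse
  \<open>k\<close>. The trivialisations also make \<open>E\<close> locally diffeomorphic to
  \<open>B \<times> F\<close>, hence a submanifold, and as \<open>F\<close> is nonempty they make
  \<open>\<pi>\<close> surjective onto \<open>B\<close>.\<close>

lemma fibers_overI:
  fixes E :: "'a::euclidean_space set" and B :: "'b::euclidean_space set" and F :: "'c::euclidean_space set"
  assumes B: "smooth_submanifold k B" and F: "smooth_submanifold l F" and dim: "k + l \<le> DIM('a)"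
    and ne: "F \<noteq> {}" and \<pi>: "smooth_map_on E \<pi>" "\<pi> ` E \<subseteq> B"
    and loc: "\<And>b. b \<in> B \<Longrightarrow> \<exists>U h k. open U \<and> b \<in> U \<and>
      smooth_map_on (E \<inter> \<pi> -` U) h \<and> smooth_map_on ((B \<inter> U) \<times> F) k \<and>
      (\<forall>x\<in>E. \<pi> x \<in> U \<longrightarrow> h x \<in> F \<and> k (\<pi> x, h x) = x) \<and>
      (\<forall>b\<in>B \<inter> U. \<forall>c\<in>F. k (b, c) \<in> E \<and> \<pi> (k (b, c)) = b \<and> h (k (b, c)) = c)"
  shows "fibers_over E B F"
proof -
  have triv: "\<exists>U \<phi>. openin (top_of_set B) U \<and> b \<in> U \<and> diffeomorphism_on (E \<inter> \<pi> -` U) (U \<times> F) \<phi> \<and>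
      (\<forall>x\<in>E \<inter> \<pi> -` U. fst (\<phi> x) = \<pi> x)" if b: "b \<in> B" for b
  proof -
    obtain U h k where U: "open U" "b \<in> U" and
      hk: "smooth_map_on (E \<inter> \<pi> -` U) h" "smooth_map_on ((B \<inter> U) \<times> F) k"
      "\<And>x. x \<in> E \<Longrightarrow> \<pi> x \<in> U \<Longrightarrow> h x \<in> F \<and> k (\<pi> x, h x) = x"
      "\<And>b c. b \<in> B \<inter> U \<Longrightarrow> c \<in> F \<Longrightarrow> k (b, c) \<in> E \<and> \<pi> (k (b, c)) = b \<and> h (k (b, c)) = c"
      using loc[OF b] by blast
    have eq: "E \<inter> \<pi> -` (B \<inter> U) = E \<inter> \<pi> -` U" using \<pi>(2) by auto
    have "smooth_map_on (E \<inter> \<pi> -` U) \<pi>" using \<pi>(1) by (rule smooth_map_on_subset) auto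
    then have "diffeomorphism_on (E \<inter> \<pi> -` (B \<inter> U)) ((B \<inter> U) \<times> F) (\<lambda>x. (\<pi> x, h x))"
      unfolding eq
      by (intro diffeomorphism_onI[OF smooth_map_on_Pair hk(2)] hk(1)) (use \<pi>(2) hk(3,4) in auto)
    then show ?thesis
      using U b by (intro exI[of _ "B \<inter> U"] exI[of _ "\<lambda>x. (\<pi> x, h x)"]) (auto intro: openin_open_Int)
  qed
  have "\<pi> ` E = B"
  proof
    show "B \<subseteq> \<pi> ` E"
    proof
      fix b assume b: "b \<in> B"
      from loc[OF this] obtain U k where "b \<in> U"
        "\<And>b c. b \<in> B \<inter> U \<Longrightarrow> c \<in> F \<Longrightarrow> k (b, c) \<in> E \<and> \<pi> (k (b, c)) = b" by blast
      with b ne show "b \<in> \<pi> ` E" by (metis IntI all_not_in_conv imageI)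
    qed
  qed (fact \<pi>(2))
  moreover have "smooth_submanifold (k + l) E"
  proof (rule smooth_submanifold_locally_diffeomorphic[OF smooth_submanifold_Times[OF B F] dim])
    fix x assume x: "x \<in> E"
    then have "\<pi> x \<in> B" using \<pi>(2) by auto
    from triv[OF this] obtain U \<phi> where U: "openin (top_of_set B) U" "\<pi> x \<in> U"
      and d: "diffeomorphism_on (E \<inter> \<pi> -` U) (U \<times> F) \<phi>" by blast
    have "openin (top_of_set E) (E \<inter> \<pi> -` U)"
      using \<pi> U(1) smooth_map_on_imp_continuous_on by (blast intro: continuous_openin_preimage)
    moreover have "openin (top_of_set (B \<times> F)) (U \<times> F)"
      using U(1) by (intro openin_Times) auto
    ultimately show "\<exists>W W' \<phi>. openin (top_of_set E) W \<and> x \<in> W \<and>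
        openin (top_of_set (B \<times> F)) W' \<and> diffeomorphism_on W W' \<phi>"
      using d x U(2) by blast
  qed
  ultimately have "smooth_fiber_bundle E B F \<pi>"
    unfolding smooth_fiber_bundle_def using B F \<pi>(1) triv by blast
  then show ?thesis unfolding fibers_over_def by blast
qed

section \<open>Transport of orthonormal frames\<close>

text \<open>Reflection in the hyperplane orthogonal to \<open>w\<close>. For \<open>w = 0\<close> it
  is the identity, so the isometry and involution laws hold for every \<open>w\<close>.\<close>

definition householder :: "'a::euclidean_space \<Rightarrow> 'a \<Rightarrow> 'a" where
  "householder w y = y - (2 * (w \<bullet> y) / (w \<bullet> w)) *\<^sub>R w"

lemma householder_inner: "householder w x \<bullet> householder w y = x \<bullet> y"
  by (cases "w = 0")
    (simp_all add: householder_def inner_diff_left inner_diff_right inner_commute field_simps)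

lemma householder_householder: "householder w (householder w y) = y"
  by (cases "w = 0") (simp_all add: householder_def inner_diff_right algebra_simps)

lemma householder_orthogonal: "w \<bullet> y = 0 \<Longrightarrow> householder w y = y"
  by (simp add: householder_def)

lemma householder_mem: "subspace L \<Longrightarrow> w \<in> L \<Longrightarrow> y \<in> L \<Longrightarrow> householder w y \<in> L"
  by (simp add: householder_def subspace_diff subspace_scale)

lemma householder_self: "householder w w = - w"
  by (cases "w = 0") (simp_all add: householder_def scaleR_2)

text \<open>\<open>p + q\<close> is the difference of \<open>q\<close> and \<open>-p\<close>, two
  vectors of equal length, so the reflection along it exchanges them.\<close>

lemma householder_sum_uminus:
  assumes "p \<bullet> p = q \<bullet> q" "p + q \<noteq> 0"
  shows "householder (p + q) (- p) = q"
proof -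
  have "(p + q) \<bullet> (p + q) = 2 * ((p + q) \<bullet> p)"
    using assms(1) by (simp add: inner_add_left inner_add_right inner_commute)
  moreover have "(p + q) \<bullet> (p + q) \<noteq> 0" using assms(2) by simp
  ultimately show ?thesis by (simp add: householder_def)
qed

lemma smooth_map_on_householder:
  assumes "smooth_map_on A f" "smooth_map_on A g" "\<And>x. x \<in> A \<Longrightarrow> f x \<noteq> 0"
  shows "smooth_map_on A (\<lambda>x. householder (f x) (g x))"
  unfolding householder_def by (intro smooth_map_on_intros assms) (use assms(3) in auto)

text \<open>The frame is moved one vector at a time: the product of the reflections in \<open>p\<close> and \<open>p + q\<close>
  is the rotation taking \<open>p\<close> to \<open>q\<close> and fixing the orthogonal complement of both.\<close>

lemma orthonormal_frame_transport:
  fixes f :: "'i \<Rightarrow> 'b::euclidean_space \<Rightarrow> 'a::euclidean_space"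
  assumes "finite A" and "\<And>a. a \<in> A \<Longrightarrow> smooth_map_on B (f a)"
    and "\<And>a b. a \<in> A \<Longrightarrow> b \<in> B \<Longrightarrow> f a b \<in> L" and L: "subspace L"
    and "\<And>a a' b. a \<in> A \<Longrightarrow> a' \<in> A \<Longrightarrow> b \<in> B \<Longrightarrow> f a b \<bullet> f a' b = of_bool (a = a')"
    and b0: "b0 \<in> B"
  shows "\<exists>U T T'. open U \<and> b0 \<in> U \<and>
    smooth_map_on ((B \<inter> U) \<times> UNIV) (\<lambda>p. T (fst p) (snd p)) \<and>
    smooth_map_on ((B \<inter> U) \<times> UNIV) (\<lambda>p. T' (fst p) (snd p)) \<and>
    (\<forall>y. T b0 y = y) \<and>
    (\<forall>b\<in>B \<inter> U. (\<forall>y. T b (T' b y) = y \<and> T' b (T b y) = y) \<and> (\<forall>x y. T b x \<bullet> T b y = x \<bullet> y) \<and>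
      T b ` L \<subseteq> L \<and> T' b ` L \<subseteq> L \<and> (\<forall>a\<in>A. T b (f a b0) = f a b))"
  using assms(1,2,3,5)
proof (induction A rule: finite_induct)
  case empty
  show ?case
    by (intro exI[of _ UNIV] exI[of _ "\<lambda>b y. y"]) (auto intro: smooth_map_on_intros)
next
  case (insert a A)
  have "\<exists>U T T'. open U \<and> b0 \<in> U \<and>
    smooth_map_on ((B \<inter> U) \<times> UNIV) (\<lambda>p. T (fst p) (snd p)) \<and>
    smooth_map_on ((B \<inter> U) \<times> UNIV) (\<lambda>p. T' (fst p) (snd p)) \<and>
    (\<forall>y. T b0 y = y) \<and>
    (\<forall>b\<in>B \<inter> U. (\<forall>y. T b (T' b y) = y \<and> T' b (T b y) = y) \<and> (\<forall>x y. T b x \<bullet> T b y = x \<bullet> y) \<and>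
      T b ` L \<subseteq> L \<and> T' b ` L \<subseteq> L \<and> (\<forall>a\<in>A. T b (f a b0) = f a b))"
    by (rule insert.IH) (use insert.prems in auto)
  then obtain U T T' where U: "open U" "b0 \<in> U"
    and sm: "smooth_map_on ((B \<inter> U) \<times> UNIV) (\<lambda>p. T (fst p) (snd p))"
      "smooth_map_on ((B \<inter> U) \<times> UNIV) (\<lambda>p. T' (fst p) (snd p))"
    and T0: "\<And>y. T b0 y = y"
    and T: "\<And>b y. b \<in> B \<inter> U \<Longrightarrow> T b (T' b y) = y" "\<And>b y. b \<in> B \<inter> U \<Longrightarrow> T' b (T b y) = y"
      "\<And>b x y. b \<in> B \<inter> U \<Longrightarrow> T b x \<bullet> T b y = x \<bullet> y"
      "\<And>b y. b \<in> B \<inter> U \<Longrightarrow> y \<in> L \<Longrightarrow> T b y \<in> L" "\<And>b y. b \<in> B \<inter> U \<Longrightarrow> y \<in> L \<Longrightarrow> T' b y \<in> L"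
      "\<And>b a. b \<in> B \<inter> U \<Longrightarrow> a \<in> A \<Longrightarrow> T b (f a b0) = f a b"
    by (auto simp: image_subset_iff)
  \<comment> \<open>The transport \<open>T\<close> built for \<open>A\<close> sends the new frame
    vector to \<open>p b\<close>; it should arrive at \<open>q b\<close>.\<close>
  define p where "p b = T b (f a b0)" for b
  define q where "q = f a"
  have sp: "smooth_map_on (B \<inter> U) p"
    unfolding p_def using smooth_map_on_compose[OF _ sm(1), of "B \<inter> U" "\<lambda>b. (b, f a b0)"]
    by (simp add: smooth_map_on_intros image_subset_iff)
  have sq: "smooth_map_on (B \<inter> U) q"
    unfolding q_def by (rule smooth_map_on_subset[of B]) (use insert.prems(1) in auto)
  have pp: "p b \<bullet> p b = 1" if "b \<in> B \<inter> U" for b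
    unfolding p_def using T(3)[OF that] insert.prems(3)[of a a b0] b0 by simp
  have qq: "q b \<bullet> q b = 1" if "b \<in> B" for b
    unfolding q_def using insert.prems(3)[of a a b] that by simp
  \<comment> \<open>The correcting rotation needs \<open>p b + q b\<close> to be nonzero. This is an
    open condition that holds at \<open>b0\<close>, where \<open>p\<close> and \<open>q\<close>
    coincide, so shrinking the neighbourhood secures it.\<close>
  have "continuous_on (B \<inter> U) (\<lambda>b. p b + q b)"
    by (intro continuous_on_add smooth_map_on_imp_continuous_on sp sq)
  then have "openin (top_of_set (B \<inter> U)) ((B \<inter> U) \<inter> (\<lambda>b. p b + q b) -` (- {0}))"
    by (intro continuous_openin_preimage_gen) auto
  then obtain U' where U': "open U'" "(B \<inter> U) \<inter> (\<lambda>b. p b + q b) -` (- {0}) = (B \<inter> U) \<inter> U'"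
    by (auto simp: openin_open)
  have *: "p b0 + q b0 = 2 *\<^sub>R q b0" by (simp add: p_def q_def T0 scaleR_2)
  moreover have "q b0 \<noteq> 0" using qq[OF b0] by auto
  ultimately have "b0 \<in> (B \<inter> U) \<inter> (\<lambda>b. p b + q b) -` (- {0})" using b0 U(2) by simp
  then have "b0 \<in> U'" unfolding U'(2) by simp
  define D where "D = B \<inter> (U \<inter> U')"
  have nz: "p b + q b \<noteq> 0" if "b \<in> D" for b
    using that U'(2) unfolding D_def by blast
  have nzp: "p b \<noteq> 0" if "b \<in> D" for b
    using that pp[of b] unfolding D_def by auto
  have DU: "b \<in> B \<inter> U" "b \<in> B" if "b \<in> D" for b using that by (auto simp: D_def)
  \<comment> \<open>Reflections along vectors of \<open>L\<close> preserve \<open>L\<close>; in the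
    application \<open>L\<close> is \<open>minus_space\<close>.\<close>
  have pL: "p b \<in> L" "q b \<in> L" if "b \<in> D" for b
    using T(4)[OF DU(1)[OF that]] insert.prems(2)[of a] b0 DU(2)[OF that] by (auto simp: p_def q_def)
  \<comment> \<open>\<open>S\<close> applies the old transport and then the rotation from
    \<open>p b\<close> to \<open>q b\<close>. \<open>S'\<close> undoes the factors in reverse order,
    each reflection being its own inverse.\<close>
  define S where "S b y = householder (p b + q b) (householder (p b) (T b y))" for b y
  define S' where "S' b y = T' b (householder (p b) (householder (p b + q b) y))" for b y
  have comp: "smooth_map_on (D \<times> UNIV) (\<lambda>z. g (fst z))" if "smooth_map_on (B \<inter> U) g" for g :: "'b \<Rightarrow> 'a"
    by (rule smooth_map_on_compose[OF _ that]) (auto intro: smooth_map_on_intros simp: D_def)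
  have sD: "smooth_map_on (D \<times> UNIV) (\<lambda>z. T (fst z) (snd z))"
    by (rule smooth_map_on_subset[OF sm(1)]) (auto simp: D_def)
  have s1: "smooth_map_on (D \<times> UNIV) (\<lambda>z. S (fst z) (snd z))"
    unfolding S_def
    by (intro smooth_map_on_householder smooth_map_on_add comp sp sq sD) (use nz nzp in auto)
  have s2: "smooth_map_on (D \<times> UNIV) (\<lambda>z. (fst z, householder (p (fst z)) (householder (p (fst z) + q (fst z)) (snd z))))"
    by (intro smooth_map_on_Pair smooth_map_on_householder smooth_map_on_add comp sp sq
        smooth_map_on_fst smooth_map_on_snd smooth_map_on_ident) (use nz nzp in auto)
  have s3: "smooth_map_on (D \<times> UNIV) (\<lambda>z. S' (fst z) (snd z))"
    using smooth_map_on_compose[OF s2 sm(2)] DU(1) by (simp add: S'_def image_subset_iff)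
  \<comment> \<open>At \<open>b0\<close> the vector \<open>p + q\<close> is
    \<open>2 *\<^sub>R q\<close>, so both factors are the same reflection and cancel.\<close>
  have S0: "S b0 y = y" for y
  proof -
    have "householder (2 *\<^sub>R q b0) z = householder (q b0) z" for z
      using qq[OF b0] by (simp add: householder_def)
    then show ?thesis
      using *
      by (simp add: S_def T0 p_def q_def householder_householder)
  qed
  have S_frame: "S b (f c b0) = f c b" if b: "b \<in> D" and c: "c \<in> insert a A" for b c
  proof (cases "c = a")
    case True
    have "S b (f c b0) = householder (p b + q b) (- p b)"
      by (simp add: S_def True p_def householder_self)
    also have "\<dots> = q b"
      using pp[OF DU(1)[OF b]] qq[OF DU(2)[OF b]] nz[OF b] by (intro householder_sum_uminus) auto
    finally show ?thesis by (simp add: q_def True)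
  next
    case False
    then have "c \<in> A" using c by auto
    then have *: "T b (f c b0) = f c b" using T(6) DU(1)[OF b] by auto
    \<comment> \<open>The old frame vectors are orthogonal to \<open>p b\<close>, because
      \<open>T b\<close> is isometric, and to \<open>q b\<close>, because the frame at
      \<open>b\<close> is orthonormal. Hence both reflections fix them.\<close>
    have "p b \<bullet> f c b = f a b0 \<bullet> f c b0"
      unfolding p_def *[symmetric] by (rule T(3)[OF DU(1)[OF b]])
    then have "p b \<bullet> f c b = 0" "q b \<bullet> f c b = 0"
      using insert.prems(3)[of a c] False \<open>c \<in> A\<close> b0 DU(2)[OF b] by (auto simp: q_def)
    then show ?thesis by (simp add: S_def * householder_orthogonal inner_add_left)
  qed
  have S: "S b (S' b y) = y" "S' b (S b y) = y" "S b x \<bullet> S b y = x \<bullet> y" if "b \<in> D" for b x y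
    using T(1-3)[OF DU(1)[OF that]] by (simp_all add: S_def S'_def householder_householder householder_inner)
  have SL: "S b y \<in> L" "S' b y \<in> L" if "b \<in> D" "y \<in> L" for b y
    unfolding S_def S'_def
    by (rule householder_mem T(5) subspace_add L pL T(4) DU(1) that)+
  have "open (U \<inter> U')" "b0 \<in> U \<inter> U'" using U U'(1) \<open>b0 \<in> U'\<close> by auto
  moreover have "(\<forall>y. S b (S' b y) = y \<and> S' b (S b y) = y) \<and> (\<forall>x y. S b x \<bullet> S b y = x \<bullet> y) \<and>
      S b ` L \<subseteq> L \<and> S' b ` L \<subseteq> L \<and> (\<forall>c\<in>insert a A. S b (f c b0) = f c b)" if b: "b \<in> D" for b
    by (intro conjI allI ballI image_subsetI) (simp_all only: S[OF b] SL[OF b] S_frame[OF b])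
  ultimately show ?case
    using s1 s3 S0 unfolding D_def
    by (intro exI[of _ "U \<inter> U'"] exI[of _ S] exI[of _ S']) simp
qed

section \<open>Anticommuting involutions\<close>

text \<open>A Clifford system with one distinguished member \<open>Q\<close>, whose eigenspaces
  organise the proof, and the others indexed by \<open>A\<close>. Nonemptiness of \<open>A\<close>
  provides an operator that exchanges the eigenspaces.\<close>

locale anticommuting_involutions =
  fixes Q :: "'a::euclidean_space \<Rightarrow> 'a" and A :: "'i set" and R :: "'i \<Rightarrow> 'a \<Rightarrow> 'a"
  assumes finite_A: "finite A" and A_nonempty: "A \<noteq> {}"
    and linear_Q: "linear Q" and linear_R: "a \<in> A \<Longrightarrow> linear (R a)"
    and Q_Q: "Q (Q x) = x" and R_R: "a \<in> A \<Longrightarrow> R a (R a x) = x"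
    and Q_sym: "Q x \<bullet> y = x \<bullet> Q y" and R_sym: "a \<in> A \<Longrightarrow> R a x \<bullet> y = x \<bullet> R a y"
    and Q_R: "a \<in> A \<Longrightarrow> Q (R a x) = - R a (Q x)"
    and R_anticomm: "a \<in> A \<Longrightarrow> b \<in> A \<Longrightarrow> a \<noteq> b \<Longrightarrow> R a (R b x) = - R b (R a x)"
begin

section \<open>Eigenspaces of \<open>Q\<close> and the splitting of vectors\<close>

definition plus_space :: "'a set" where "plus_space = {x. Q x = x}"
definition minus_space :: "'a set" where "minus_space = {x. Q x = - x}"

text \<open>The eigencomponents, scaled so that both are unit vectors for a unit vector \<open>x\<close> with
  \<open>Q x \<bullet> x = 0\<close>.\<close>

definition plus_part :: "'a \<Rightarrow> 'a" where "plus_part x = (1 / sqrt 2) *\<^sub>R (x + Q x)"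
definition minus_part :: "'a \<Rightarrow> 'a" where "minus_part x = (1 / sqrt 2) *\<^sub>R (x - Q x)"
definition join :: "'a \<Rightarrow> 'a \<Rightarrow> 'a" where "join u v = (1 / sqrt 2) *\<^sub>R (u + v)"

lemmas Q_simps = linear_add[OF linear_Q] linear_diff[OF linear_Q] linear_scale[OF linear_Q]
  linear_neg[OF linear_Q] linear_sum[OF linear_Q] linear_0[OF linear_Q]

lemma subspace_plus_space: "subspace plus_space"
  by (rule subspaceI) (auto simp: plus_space_def Q_simps)

lemma subspace_minus_space: "subspace minus_space"
  by (rule subspaceI) (auto simp: minus_space_def Q_simps)

lemma linear_plus_part: "linear plus_part"
  by (rule linearI) (simp_all add: plus_part_def Q_simps algebra_simps)

lemma linear_minus_part: "linear minus_part"
  by (rule linearI) (simp_all add: minus_part_def Q_simps algebra_simps)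

lemma plus_part_mem: "plus_part x \<in> plus_space"
  by (simp add: plus_space_def plus_part_def Q_simps Q_Q add.commute)

lemma minus_part_mem: "minus_part x \<in> minus_space"
  by (simp add: minus_space_def minus_part_def Q_simps Q_Q algebra_simps)

lemma join_parts: "join (plus_part x) (minus_part x) = x"
proof -
  have "join (plus_part x) (minus_part x) = (1 / sqrt 2 * (1 / sqrt 2)) *\<^sub>R (2 *\<^sub>R x)"
    unfolding join_def plus_part_def minus_part_def scaleR_2 scaleR_scaleR[symmetric]
    by (simp add: scaleR_add_right[symmetric] del: scaleR_scaleR)
  then show ?thesis by simp
qed

lemma plus_part_join: "u \<in> plus_space \<Longrightarrow> v \<in> minus_space \<Longrightarrow> plus_part (join u v) = u"
proof -
  assume "u \<in> plus_space" "v \<in> minus_space"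
  then have "plus_part (join u v) = (1 / sqrt 2 * (1 / sqrt 2)) *\<^sub>R (2 *\<^sub>R u)"
    unfolding join_def plus_part_def plus_space_def minus_space_def scaleR_2 scaleR_scaleR[symmetric]
    by (simp add: Q_simps scaleR_add_right[symmetric] del: scaleR_scaleR)
  then show ?thesis by simp
qed

lemma minus_part_join: "u \<in> plus_space \<Longrightarrow> v \<in> minus_space \<Longrightarrow> minus_part (join u v) = v"
proof -
  assume "u \<in> plus_space" "v \<in> minus_space"
  then have "minus_part (join u v) = (1 / sqrt 2 * (1 / sqrt 2)) *\<^sub>R (2 *\<^sub>R v)"
    unfolding join_def minus_part_def plus_space_def minus_space_def scaleR_2 scaleR_scaleR[symmetric]
    by (simp add: Q_simps scaleR_diff_right[symmetric] del: scaleR_scaleR)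
  then show ?thesis by simp
qed

lemma R_mem_minus: "a \<in> A \<Longrightarrow> u \<in> plus_space \<Longrightarrow> R a u \<in> minus_space"
  by (simp add: plus_space_def minus_space_def Q_R)

lemma R_mem_plus: "a \<in> A \<Longrightarrow> v \<in> minus_space \<Longrightarrow> R a v \<in> plus_space"
  by (simp add: plus_space_def minus_space_def Q_R linear_neg[OF linear_R])

lemma plus_minus_orthogonal: "u \<in> plus_space \<Longrightarrow> v \<in> minus_space \<Longrightarrow> u \<bullet> v = 0"
  using Q_sym[of u v] by (simp add: plus_space_def minus_space_def)

text \<open>\<open>Q\<close> is a symmetric involution and hence an isometry, so the cross terms
  alone separate the result from \<open>x \<bullet> x\<close>.\<close>

lemma inner_plus_part: "plus_part x \<bullet> plus_part x = x \<bullet> x + Q x \<bullet> x"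
proof -
  have "Q x \<bullet> Q x = x \<bullet> x" by (simp add: Q_sym Q_Q)
  then show ?thesis
    by (simp add: plus_part_def inner_add_left inner_add_right inner_commute)
qed

lemma inner_minus_part: "minus_part x \<bullet> minus_part x = x \<bullet> x - Q x \<bullet> x"
proof -
  have "Q x \<bullet> Q x = x \<bullet> x" by (simp add: Q_sym Q_Q)
  then show ?thesis
    by (simp add: minus_part_def inner_diff_left inner_diff_right inner_commute)
qed

text \<open>For distinct indices, symmetry and anticommutation make
  \<open>R a x \<bullet> R b x\<close> equal to its own negative. Thus the \<open>R a x\<close> are
  orthonormal when \<open>x\<close> is a unit vector.\<close>

lemma inner_R_R:
  assumes "a \<in> A" "b \<in> A"
  shows "R a x \<bullet> R b x = of_bool (a = b) * (x \<bullet> x)"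
proof (cases "a = b")
  case True
  then show ?thesis using assms by (simp add: R_sym R_R)
next
  case False
  have "R a x \<bullet> R b x = - (R b x \<bullet> R a x)"
    using assms False by (simp add: R_sym R_anticomm[of a b])
  then show ?thesis using False by (simp add: inner_commute)
qed

lemma inner_Q_R: "a \<in> A \<Longrightarrow> Q x \<bullet> R a x = 0"
  using Q_R[of a x] Q_sym[of x "R a x"] R_sym[of a x "Q x"] by (simp add: inner_commute)

text \<open>The mixed terms vanish by \<open>inner_Q_R\<close>, and the other two agree because
  \<open>Q\<close> and \<open>R a\<close> anticommute. A quadratic equation in \<open>x\<close>
  thereby becomes an orthogonality relation between its eigencomponents.\<close>

lemma minus_part_inner_R_plus_part:
  assumes a: "a \<in> A"
  shows "minus_part x \<bullet> R a (plus_part x) = R a x \<bullet> x"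
proof -
  note lin = linear_add[OF linear_R[OF a]] linear_scale[OF linear_R[OF a]]
  have "x \<bullet> R a (Q x) = 0" using inner_Q_R[OF a, of x] R_sym[OF a, of x "Q x"] by (simp add: inner_commute)
  moreover have "Q x \<bullet> R a (Q x) = - (x \<bullet> R a x)"
    using Q_sym[of x "R a (Q x)"] Q_R[OF a, of "Q x"] by (simp add: Q_Q)
  ultimately show ?thesis
    using inner_Q_R[OF a, of x]
    by (simp add: minus_part_def plus_part_def lin inner_diff_left inner_diff_right inner_add_right inner_commute)
qed

lemma minus_part_R:
  assumes a: "a \<in> A"
  shows "minus_part (R a x) = R a (plus_part x)"
  by (simp add: minus_part_def plus_part_def Q_R[OF a] linear_add[OF linear_R[OF a]] linear_scale[OF linear_R[OF a]])

text \<open>Any \<open>R a\<close> swaps the two eigenspaces of \<open>Q\<close>.\<close>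

lemma dim_eigenspaces:
  shows "2 * dim plus_space = DIM('a)" "2 * dim minus_space = DIM('a)"
proof -
  obtain a where a: "a \<in> A" using A_nonempty by blast
  have le: "dim S \<le> dim T" if "\<And>x. x \<in> S \<Longrightarrow> R a x \<in> T" for S T
  proof -
    have "inj (R a)" by (metis R_R[OF a] injI)
    then have "dim (R a ` S) = dim S"
      using linear_R[OF a] by (intro dim_image_eq) (auto intro: inj_on_subset)
    moreover have "dim (R a ` S) \<le> dim T" using that by (intro dim_subset) auto
    ultimately show ?thesis by simp
  qed
  have eq: "dim plus_space = dim minus_space"
    by (intro antisym le) (auto intro: R_mem_minus R_mem_plus a)
  have sub: "plus_space \<inter> minus_space \<subseteq> {0}"
    using plus_minus_orthogonal by fastforce
  have "x \<in> {x + y |x y. x \<in> plus_space \<and> y \<in> minus_space}" for x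
  proof (intro CollectI exI conjI)
    show "x = (1 / sqrt 2) *\<^sub>R plus_part x + (1 / sqrt 2) *\<^sub>R minus_part x"
      using join_parts[of x] by (simp add: join_def scaleR_add_right)
  qed (intro subspace_scale subspace_plus_space subspace_minus_space plus_part_mem minus_part_mem)+
  then have "{x + y |x y. x \<in> plus_space \<and> y \<in> minus_space} = UNIV" by blast
  then have "DIM('a) + dim (plus_space \<inter> minus_space) = dim plus_space + dim minus_space"
    using dim_sums_Int[OF subspace_plus_space subspace_minus_space] by simp
  moreover have "dim (plus_space \<inter> minus_space) = 0" using sub by (simp add: dim_eq_0)
  ultimately show "2 * dim plus_space = DIM('a)" "2 * dim minus_space = DIM('a)" using eq by auto
qed

section \<open>The two sets in terms of eigencomponents\<close>

definition focal_set :: "'a set" where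
  "focal_set = {x. x \<bullet> x = 1 \<and> Q x \<bullet> x = 0 \<and> (\<forall>a\<in>A. R a x \<bullet> x = 0)}"

definition spherical_set :: "'a set" where
  "spherical_set = {x. x \<bullet> x = 1 \<and> (\<Sum>a\<in>A. (R a x \<bullet> x)\<^sup>2) = 1}"

text \<open>The squared lengths of the two parts are the sum and the difference of
  \<open>x \<bullet> x\<close> and \<open>Q x \<bullet> x\<close>; both are 1 exactly when these are
  1 and 0.\<close>

lemma focal_set_iff:
  "x \<in> focal_set \<longleftrightarrow> plus_part x \<bullet> plus_part x = 1 \<and> minus_part x \<bullet> minus_part x = 1 \<and>
     (\<forall>a\<in>A. minus_part x \<bullet> R a (plus_part x) = 0)"
  by (auto simp: focal_set_def inner_plus_part inner_minus_part minus_part_inner_R_plus_part)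

text \<open>Equality in Bessel's inequality for the orthonormal vectors \<open>R a x\<close>.\<close>

lemma spherical_set_expand:
  assumes "x \<in> spherical_set"
  shows "(\<Sum>a\<in>A. (R a x \<bullet> x) *\<^sub>R R a x) = x"
proof -
  define c where "c a = R a x \<bullet> x" for a
  \<comment> \<open>\<open>y\<close> is the orthogonal projection of \<open>x\<close> onto the span
    of the \<open>R a x\<close>. Since \<open>y \<bullet> x\<close>, \<open>y \<bullet> y\<close>
    and \<open>x \<bullet> x\<close> are all 1, the difference has length zero.\<close>
  define y where "y = (\<Sum>a\<in>A. c a *\<^sub>R R a x)"
  have x: "x \<bullet> x = 1" "(\<Sum>a\<in>A. (c a)\<^sup>2) = 1" using assms by (auto simp: spherical_set_def c_def)
  have yx: "y \<bullet> x = 1"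
    unfolding x(2)[symmetric] by (simp add: y_def inner_sum_left c_def power2_eq_square)
  have yR: "y \<bullet> R b x = c b" if "b \<in> A" for b
    unfolding y_def inner_sum_left using that finite_A
    by (simp add: inner_R_R x(1) of_bool_def if_distrib[of "(*) _"] cong: if_cong)
  have "y \<bullet> y = (\<Sum>a\<in>A. c a * (y \<bullet> R a x))"
    by (subst (2) y_def) (simp add: inner_sum_right)
  also have "\<dots> = 1" using x(2) by (simp add: yR power2_eq_square)
  finally have "(y - x) \<bullet> (y - x) = 0"
    using x yx by (simp add: inner_diff_left inner_diff_right inner_commute)
  then show ?thesis by (simp add: y_def c_def)
qed

text \<open>Apply \<open>minus_part\<close> to the expansion of \<open>x\<close>; by
  \<open>minus_part_R\<close> it turns each \<open>R a x\<close> into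
  \<open>R a (plus_part x)\<close>.\<close>

lemma spherical_set_minus_part:
  assumes "x \<in> spherical_set"
  shows "(\<Sum>a\<in>A. (R a x \<bullet> x) *\<^sub>R R a (plus_part x)) = minus_part x"
proof -
  have "minus_part x = minus_part (\<Sum>a\<in>A. (R a x \<bullet> x) *\<^sub>R R a x)"
    by (simp only: spherical_set_expand[OF assms])
  then show ?thesis
    by (simp add: linear_sum[OF linear_minus_part] linear_scale[OF linear_minus_part] minus_part_R)
qed

text \<open>\<open>Q x\<close> is orthogonal to every \<open>R a x\<close>, hence to
  \<open>x\<close>, which is a combination of them.\<close>

lemma spherical_set_plus_part:
  assumes "x \<in> spherical_set"
  shows "plus_part x \<bullet> plus_part x = 1"
proof -
  have "Q x \<bullet> x = Q x \<bullet> (\<Sum>a\<in>A. (R a x \<bullet> x) *\<^sub>R R a x)"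
    by (simp only: spherical_set_expand[OF assms])
  also have "\<dots> = 0" by (simp add: inner_sum_right inner_Q_R)
  finally show ?thesis using assms by (simp add: inner_plus_part spherical_set_def)
qed

text \<open>The inverse direction: the \<open>R a u\<close> are orthonormal in
  \<open>minus_space\<close>, so unit coefficients \<open>c\<close> give a unit vector there, and
  \<open>c\<close> is recovered by pairing it with the \<open>R a u\<close>.\<close>

lemma
  assumes u: "u \<in> plus_space" "u \<bullet> u = 1" and c: "(\<Sum>a\<in>A. (c a)\<^sup>2) = 1"
  defines "x \<equiv> join u (\<Sum>a\<in>A. c a *\<^sub>R R a u)"
  shows join_mem_spherical_set: "x \<in> spherical_set"
    and plus_part_join_spherical: "plus_part x = u"
    and inner_R_join_spherical: "a \<in> A \<Longrightarrow> R a x \<bullet> x = c a"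
proof -
  define v where "v = (\<Sum>a\<in>A. c a *\<^sub>R R a u)"
  have v: "v \<in> minus_space"
    unfolding v_def by (intro subspace_sum subspace_scale subspace_minus_space R_mem_minus u)
  have x: "x = join u v" by (simp add: x_def v_def)
  show p: "plus_part x = u" unfolding x using u v by (intro plus_part_join)
  have m: "minus_part x = v" unfolding x using u v by (intro minus_part_join)
  have vR: "v \<bullet> R b u = c b" if "b \<in> A" for b
    unfolding v_def inner_sum_left using that finite_A
    by (simp add: inner_R_R u(2) of_bool_def if_distrib[of "(*) _"] cong: if_cong)
  show R: "R a x \<bullet> x = c a" if "a \<in> A" for a
    using minus_part_inner_R_plus_part[OF that, of x] vR[OF that] by (simp add: p m)
  have "v \<bullet> v = (\<Sum>a\<in>A. c a * (v \<bullet> R a u))"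
    by (subst (2) v_def) (simp add: inner_sum_right)
  also have "\<dots> = 1" using vR c by (simp add: power2_eq_square)
  finally have "x \<bullet> x = 1"
    using inner_plus_part[of x] inner_minus_part[of x] u(2) by (simp add: p m)
  then show "x \<in> spherical_set" using R c by (simp add: spherical_set_def)
qed

text \<open>The map \<open>g\<close> need not be an isometry outside \<open>plus_space\<close>.\<close>

lemma plus_space_coordinatesE:
  assumes "DIM('a) = 2 * DIM('b::euclidean_space)"
  obtains j :: "'b::euclidean_space \<Rightarrow> 'a" and g :: "'a \<Rightarrow> 'b::euclidean_space" where
    "linear j" "linear g" "\<And>b. j b \<in> plus_space" "\<And>b. norm (j b) = norm b"
    "\<And>x. x \<in> plus_space \<Longrightarrow> norm (g x) = norm x" "\<And>b. g (j b) = b" "\<And>x. x \<in> plus_space \<Longrightarrow> j (g x) = x"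
proof -
  have "dim (UNIV :: 'b set) = dim plus_space" using dim_eigenspaces assms by simp
  from isometries_subspaces[OF subspace_UNIV subspace_plus_space this]
  obtain j :: "'b \<Rightarrow> 'a" and g where "linear j" "linear g" "j ` UNIV = plus_space"
    "\<And>x. norm (j x) = norm x" "\<And>x. x \<in> plus_space \<Longrightarrow> norm (g x) = norm x"
    "\<And>x. g (j x) = x" "\<And>x. x \<in> plus_space \<Longrightarrow> j (g x) = x"
    by (metis UNIV_I)
  then show ?thesis by (intro that[of j g]) auto
qed

section \<open>Trivialisations of the two bundles\<close>

lemma smooth_map_on_join:
  "smooth_map_on S f \<Longrightarrow> smooth_map_on S h \<Longrightarrow> smooth_map_on S (\<lambda>x. join (f x) (h x))"
  unfolding join_def by (intro smooth_map_on_intros)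

lemma spherical_set_fibers_over:
  assumes dims: "DIM('a) = 2 * DIM('b::euclidean_space)" "card A = DIM('c::euclidean_space)"
    "DIM('c) \<le> DIM('b)"
  shows "fibers_over spherical_set (sphere 0 1 :: 'b set) (sphere 0 1 :: 'c set)"
proof -
  obtain j :: "'b \<Rightarrow> 'a" and g :: "'a \<Rightarrow> 'b" where j: "linear j" and g: "linear g" and
    jg: "\<And>b. j b \<in> plus_space" "\<And>b. norm (j b) = norm b"
    "\<And>x. x \<in> plus_space \<Longrightarrow> norm (g x) = norm x" "\<And>b. g (j b) = b" "\<And>x. x \<in> plus_space \<Longrightarrow> j (g x) = x"
    using plus_space_coordinatesE[OF dims(1)] by metis
  \<comment> \<open>\<open>e\<close> labels the standard basis of \<open>'c\<close> by
    \<open>A\<close>, so that the coefficients \<open>R a x \<bullet> x\<close> form a vector of the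
    fibre sphere.\<close>
  obtain e where e: "bij_betw e A (Basis :: 'c set)"
    using finite_same_card_bij[OF finite_A finite_Basis] dims(2) by auto
  define \<pi> where "\<pi> x = g (plus_part x)" for x
  define h where "h x = (\<Sum>a\<in>A. (R a x \<bullet> x) *\<^sub>R e a)" for x
  define k where "k p = join (j (fst p)) (\<Sum>a\<in>A. (snd p \<bullet> e a) *\<^sub>R R a (j (fst p)))" for p
  have sum_e: "(\<Sum>a\<in>A. f (e a)) = sum f Basis" for f :: "'c \<Rightarrow> 'd::comm_monoid_add"
    by (rule sum.reindex_bij_betw[OF e])
  have h_e: "(\<Sum>a\<in>A. r a *\<^sub>R e a) \<bullet> e b = r b" if "b \<in> A" for r b
  proof -
    have ee: "e a \<bullet> e b = (if a = b then 1 else 0)" if "a \<in> A" for a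
      using e \<open>b \<in> A\<close> that
      by (simp add: inner_Basis bij_betwE bij_betw_imp_inj_on[THEN inj_on_eq_iff])
    have "(\<Sum>a\<in>A. r a *\<^sub>R e a) \<bullet> e b = (\<Sum>a\<in>A. if a = b then r a else 0)"
      unfolding inner_sum_left by (intro sum.cong) (simp_all add: ee)
    then show ?thesis using that finite_A by simp
  qed
  have norm_c: "(\<Sum>a\<in>A. (c \<bullet> e a)\<^sup>2) = 1 \<longleftrightarrow> norm c = 1" for c :: 'c
    using sum_e[of "\<lambda>b. (c \<bullet> b)\<^sup>2"] by (simp add: norm_eq_1 euclidean_inner[of c c] power2_eq_square)
  have sm: "smooth_map_on S (\<lambda>x. g (plus_part x))" "a \<in> A \<Longrightarrow> smooth_map_on S (R a)" for S a
    using linear_plus_part g linear_R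
    by (auto intro: smooth_map_on_compose_linear smooth_map_on_linear)
  have h: "h x \<in> sphere 0 1" "k (\<pi> x, h x) = x" "\<pi> x \<in> sphere 0 1" if x: "x \<in> spherical_set" for x
  proof -
    have he: "h x \<bullet> e a = R a x \<bullet> x" if "a \<in> A" for a
      unfolding h_def by (rule h_e[OF that])
    have "(\<Sum>a\<in>A. (h x \<bullet> e a)\<^sup>2) = 1" using x he by (simp add: spherical_set_def)
    then show "h x \<in> sphere 0 1" by (simp add: norm_c)
    have jp: "j (\<pi> x) = plus_part x" by (simp add: \<pi>_def jg plus_part_mem)
    then have "k (\<pi> x, h x) = join (plus_part x) (\<Sum>a\<in>A. (R a x \<bullet> x) *\<^sub>R R a (plus_part x))"
      by (simp add: k_def he)
    then show "k (\<pi> x, h x) = x" by (simp add: spherical_set_minus_part[OF x] join_parts)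
    show "\<pi> x \<in> sphere 0 1"
      using jg(2)[of "\<pi> x"] spherical_set_plus_part[OF x] by (simp add: jp norm_eq_1[symmetric])
  qed
  have k: "k (b, c) \<in> spherical_set" "\<pi> (k (b, c)) = b" "h (k (b, c)) = c"
    if bc: "b \<in> sphere 0 1" "c \<in> sphere 0 1" for b c
  proof -
    have u: "j b \<in> plus_space" "j b \<bullet> j b = 1" and c: "(\<Sum>a\<in>A. (c \<bullet> e a)\<^sup>2) = 1"
      using bc jg by (auto simp: norm_c norm_eq_1[symmetric])
    show "k (b, c) \<in> spherical_set" using join_mem_spherical_set[OF u c] by (simp add: k_def)
    show "\<pi> (k (b, c)) = b" using plus_part_join_spherical[OF u c] by (simp add: k_def \<pi>_def jg)
    have "h (k (b, c)) = (\<Sum>a\<in>A. (c \<bullet> e a) *\<^sub>R e a)"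
      unfolding h_def using inner_R_join_spherical[OF u c] by (intro sum.cong) (simp_all add: k_def)
    then show "h (k (b, c)) = c"
      using sum_e[of "\<lambda>b. (c \<bullet> b) *\<^sub>R b"] by (simp add: euclidean_representation)
  qed
  show ?thesis
  proof (rule fibers_overI[OF smooth_submanifold_sphere smooth_submanifold_sphere])
    show "DIM('b) - 1 + (DIM('c) - 1) \<le> DIM('a)" using dims by simp
    show "smooth_map_on spherical_set \<pi>" unfolding \<pi>_def by (rule sm)
    have "smooth_map_on S h" for S
      unfolding h_def by (intro smooth_map_on_intros sm)
    moreover have "smooth_map_on S k" for S
      unfolding k_def
      by (intro smooth_map_on_join smooth_map_on_intros smooth_map_on_compose_linear[OF linear_R]
          smooth_map_on_compose_linear[OF j])
    ultimately show "\<exists>U h k. open U \<and> b \<in> U \<and>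
        smooth_map_on (spherical_set \<inter> \<pi> -` U) h \<and> smooth_map_on ((sphere 0 1 \<inter> U) \<times> sphere 0 1) k \<and>
        (\<forall>x\<in>spherical_set. \<pi> x \<in> U \<longrightarrow> h x \<in> (sphere 0 1 :: 'c set) \<and> k (\<pi> x, h x) = x) \<and>
        (\<forall>b\<in>sphere 0 1 \<inter> U. \<forall>c\<in>sphere 0 1. k (b, c) \<in> spherical_set \<and> \<pi> (k (b, c)) = b \<and> h (k (b, c)) = c)"
      for b
      \<comment> \<open>The formulas for \<open>h\<close> and \<open>k\<close> work over the whole
        base, hence \<open>U\<close> is \<open>UNIV\<close>.\<close>
      using h k by (intro exI[of _ UNIV] exI[of _ h] exI[of _ k]) simp
  qed (use h in auto)
qed

text \<open>The fibre over \<open>b\<close> is the unit sphere in the part of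
  \<open>minus_space\<close> orthogonal to the frame \<open>R a (j b)\<close>. This subspace varies
  with \<open>b\<close>, so it is identified with the one at \<open>b0\<close> by the frame
  transport, which exists near \<open>b0\<close>.\<close>

lemma focal_set_fibers_over:
  assumes dims: "DIM('a) = 2 * DIM('b::euclidean_space)" "DIM('c::euclidean_space) + card A = DIM('b)"
  shows "fibers_over focal_set (sphere 0 1 :: 'b set) (sphere 0 1 :: 'c set)"
proof -
  obtain j :: "'b \<Rightarrow> 'a" and g :: "'a \<Rightarrow> 'b" where j: "linear j" and g: "linear g" and
    jg: "\<And>b. j b \<in> plus_space" "\<And>b. norm (j b) = norm b"
    "\<And>x. x \<in> plus_space \<Longrightarrow> norm (g x) = norm x" "\<And>b. g (j b) = b" "\<And>x. x \<in> plus_space \<Longrightarrow> j (g x) = x"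
    using plus_space_coordinatesE[OF dims(1)] by metis
  define \<pi> where "\<pi> x = g (plus_part x)" for x
  have sm: "smooth_map_on S \<pi>" for S
    unfolding \<pi>_def using linear_plus_part g
    by (auto intro: smooth_map_on_compose_linear smooth_map_on_linear)
  have j\<pi>: "j (\<pi> x) = plus_part x" for x by (simp add: \<pi>_def jg plus_part_mem)
  have \<pi>_sphere: "\<pi> x \<in> sphere 0 1" if x: "x \<in> focal_set" for x
    using jg(2)[of "\<pi> x"] x by (simp add: j\<pi> norm_eq_1[symmetric] focal_set_iff)
  define f where "f a b = R a (j b)" for a b
  have f_smooth: "smooth_map_on S (f a)" if "a \<in> A" for S a
    unfolding f_def by (rule smooth_map_on_compose_linear[OF linear_R[OF that] smooth_map_on_linear[OF j]])
  have f_mem: "f a b \<in> minus_space" if "a \<in> A" for a b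
    unfolding f_def using that jg(1) by (rule R_mem_minus)
  have f_orth: "f a b \<bullet> f a' b = of_bool (a = a')" if "a \<in> A" "a' \<in> A" "b \<in> sphere 0 1" for a a' b
    using that inner_R_R[of a a' "j b"] jg(2)[of b] by (simp add: f_def norm_eq_1[symmetric])
  have triv: "\<exists>U h k. open U \<and> b0 \<in> U \<and>
        smooth_map_on (focal_set \<inter> \<pi> -` U) h \<and> smooth_map_on ((sphere 0 1 \<inter> U) \<times> sphere 0 1) k \<and>
        (\<forall>x\<in>focal_set. \<pi> x \<in> U \<longrightarrow> h x \<in> sphere 0 1 \<and> k (\<pi> x, h x) = x) \<and>
        (\<forall>b\<in>sphere 0 1 \<inter> U. \<forall>c\<in>(sphere 0 1 :: 'c set).
           k (b, c) \<in> focal_set \<and> \<pi> (k (b, c)) = b \<and> h (k (b, c)) = c)"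
    if b0: "b0 \<in> sphere 0 1" for b0
  proof -
    obtain U T T' where U: "open U" "b0 \<in> U"
      and smT: "smooth_map_on ((sphere 0 1 \<inter> U) \<times> UNIV) (\<lambda>p. T (fst p) (snd p))"
        "smooth_map_on ((sphere 0 1 \<inter> U) \<times> UNIV) (\<lambda>p. T' (fst p) (snd p))"
      and T: "\<And>b y. b \<in> sphere 0 1 \<inter> U \<Longrightarrow> T b (T' b y) = y" "\<And>b y. b \<in> sphere 0 1 \<inter> U \<Longrightarrow> T' b (T b y) = y"
        "\<And>b x y. b \<in> sphere 0 1 \<inter> U \<Longrightarrow> T b x \<bullet> T b y = x \<bullet> y"
        "\<And>b y. b \<in> sphere 0 1 \<inter> U \<Longrightarrow> y \<in> minus_space \<Longrightarrow> T b y \<in> minus_space"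
        "\<And>b y. b \<in> sphere 0 1 \<inter> U \<Longrightarrow> y \<in> minus_space \<Longrightarrow> T' b y \<in> minus_space"
        "\<And>b a. b \<in> sphere 0 1 \<inter> U \<Longrightarrow> a \<in> A \<Longrightarrow> T b (f a b0) = f a b"
      using orthonormal_frame_transport[OF finite_A f_smooth f_mem subspace_minus_space f_orth b0]
      by (fastforce simp: image_subset_iff)
    define V where "V = span ((\<lambda>a. f a b0) ` A)"
    \<comment> \<open>The model fibre is the unit sphere of \<open>W\<close>, the complement of the
      frame at \<open>b0\<close>. Its dimension is that of \<open>minus_space\<close> minus
      \<open>card A\<close>, which is \<open>DIM('c)\<close>.\<close>
    define W where "W = {y \<in> minus_space. \<forall>x\<in>V. orthogonal x y}"
    have W_iff: "y \<in> W \<longleftrightarrow> y \<in> minus_space \<and> (\<forall>a\<in>A. y \<bullet> f a b0 = 0)" for y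
    proof -
      have "(\<forall>x\<in>V. orthogonal x y) \<longleftrightarrow> (\<forall>x\<in>(\<lambda>a. f a b0) ` A. orthogonal y x)"
        unfolding V_def by (metis orthogonal_commute orthogonal_to_span span_base)
      then show ?thesis by (auto simp: W_def orthogonal_def)
    qed
    have "subspace W"
      by (rule subspaceI) (use subspace_minus_space in
        \<open>auto simp: W_iff inner_add_left intro: subspace_0 subspace_add subspace_scale\<close>)
    have f_unit: "f a b0 \<bullet> f a b0 = 1" if "a \<in> A" for a
      using f_orth[OF that that b0] by simp
    have f_zero: "f a b0 \<bullet> f a' b0 = 0" if "a \<in> A" "a' \<in> A" "a \<noteq> a'" for a a'
      using f_orth[OF that(1,2) b0] that(3) by simp
    have "inj_on (\<lambda>a. f a b0) A"
    proof (rule inj_onI, rule ccontr)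
      fix a a' assume "a \<in> A" "a' \<in> A" "f a b0 = f a' b0" "a \<noteq> a'"
      then show False using f_zero[of a a'] f_unit[of a'] by simp
    qed
    moreover have "independent ((\<lambda>a. f a b0) ` A)"
    proof (rule pairwise_orthogonal_independent)
      show "pairwise orthogonal ((\<lambda>a. f a b0) ` A)"
        using f_zero by (fastforce simp: pairwise_image pairwise_def orthogonal_def)
      show "0 \<notin> (\<lambda>a. f a b0) ` A"
      proof
        assume "0 \<in> (\<lambda>a. f a b0) ` A"
        then obtain a where "a \<in> A" "f a b0 = 0" by auto
        then show False using f_unit[of a] by simp
      qed
    qed
    ultimately have "dim V = card A"
      by (simp add: V_def dim_eq_card_independent card_image)
    moreover have "dim W + dim V = dim minus_space"
    proof -
      have "V \<subseteq> minus_space"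
        unfolding V_def by (intro span_minimal subspace_minus_space) (auto intro: f_mem)
      then show ?thesis
        unfolding W_def
        by (intro dim_subspace_orthogonal_to_vectors subspace_minus_space) (auto simp: V_def)
    qed
    ultimately have "dim (UNIV :: 'c set) = dim W" using dims dim_eigenspaces(2) by simp
    from isometries_subspaces[OF subspace_UNIV \<open>subspace W\<close> this]
    obtain \<kappa> :: "'c \<Rightarrow> 'a" and \<kappa>' where \<kappa>: "linear \<kappa>" "linear \<kappa>'" "\<kappa> ` UNIV = W"
      "\<And>c. norm (\<kappa> c) = norm c" "\<And>y. y \<in> W \<Longrightarrow> norm (\<kappa>' y) = norm y"
      "\<And>c. \<kappa>' (\<kappa> c) = c" "\<And>y. y \<in> W \<Longrightarrow> \<kappa> (\<kappa>' y) = y"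
      by (metis UNIV_I)
    \<comment> \<open>The minus part is carried back to the fibre over \<open>b0\<close> and read in
      the isometric coordinates \<open>\<kappa>'\<close> of \<open>W\<close>; \<open>k\<close>
      reverses this.\<close>
    define h where "h x = \<kappa>' (T' (\<pi> x) (minus_part x))" for x
    define k where "k p = join (j (fst p)) (T (fst p) (\<kappa> (snd p)))" for p
    have "smooth_map_on (focal_set \<inter> \<pi> -` U) (\<lambda>x. T' (fst (\<pi> x, minus_part x)) (snd (\<pi> x, minus_part x)))"
      by (rule smooth_map_on_compose[OF smooth_map_on_Pair[OF sm smooth_map_on_linear[OF linear_minus_part]] smT(2)])
        (auto simp: \<pi>_sphere[simplified])
    then have "smooth_map_on (focal_set \<inter> \<pi> -` U) h"
      unfolding h_def by (intro smooth_map_on_compose_linear[OF \<kappa>(2)]) simp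
    moreover have "smooth_map_on ((sphere 0 1 \<inter> U) \<times> sphere 0 1)
        (\<lambda>p. T (fst (fst p, \<kappa> (snd p))) (snd (fst p, \<kappa> (snd p))))"
      by (rule smooth_map_on_compose[OF _ smT(1)])
        (auto intro!: smooth_map_on_intros smooth_map_on_compose_linear[OF \<kappa>(1)])
    then have "smooth_map_on ((sphere 0 1 \<inter> U) \<times> sphere 0 1) k"
      unfolding k_def
      by (intro smooth_map_on_join smooth_map_on_compose_linear[OF j] smooth_map_on_intros) simp
    moreover have "h x \<in> sphere 0 1 \<and> k (\<pi> x, h x) = x" if x: "x \<in> focal_set" "\<pi> x \<in> U" for x
    proof -
      have b: "\<pi> x \<in> sphere 0 1 \<inter> U" using \<pi>_sphere x by auto
      define y where "y = T' (\<pi> x) (minus_part x)"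
      \<comment> \<open>The isometry property is available for \<open>T\<close>, so the facts about
        \<open>y\<close> are read off from its image.\<close>
      have Ty: "T (\<pi> x) y = minus_part x" by (simp only: y_def T(1)[OF b])
      have "y \<bullet> f a b0 = 0" if "a \<in> A" for a
      proof -
        have "y \<bullet> f a b0 = minus_part x \<bullet> f a (\<pi> x)"
          using T(3)[OF b, of y "f a b0"] by (simp only: Ty T(6)[OF b that])
        also have "\<dots> = 0" using x(1) that by (simp add: f_def j\<pi> focal_set_iff)
        finally show ?thesis .
      qed
      then have W: "y \<in> W" by (simp add: W_iff y_def T(5)[OF b minus_part_mem])
      have "y \<bullet> y = 1" using T(3)[OF b, of y y] x(1) by (simp add: Ty focal_set_iff)
      then have "norm (h x) = 1" using \<kappa>(5)[OF W] by (simp add: h_def y_def[symmetric] norm_eq_1)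
      moreover have "k (\<pi> x, h x) = x"
        by (simp add: k_def h_def y_def[symmetric] \<kappa>(7)[OF W] Ty j\<pi> join_parts)
      ultimately show ?thesis by simp
    qed
    moreover have "k (b, c) \<in> focal_set \<and> \<pi> (k (b, c)) = b \<and> h (k (b, c)) = c"
      if b: "b \<in> sphere 0 1 \<inter> U" and c: "c \<in> sphere 0 1" for b c
    proof -
      define v where "v = T b (\<kappa> c)"
      have W: "\<kappa> c \<in> W" using \<kappa>(3) by auto
      have v: "v \<in> minus_space" unfolding v_def using W by (intro T(4)[OF b]) (simp add: W_iff)
      have k: "k (b, c) = join (j b) v" by (simp add: k_def v_def)
      have pm: "plus_part (k (b, c)) = j b" "minus_part (k (b, c)) = v"
        unfolding k using jg(1) v by (simp_all add: plus_part_join minus_part_join)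
      have "v \<bullet> R a (j b) = 0" if "a \<in> A" for a
      proof -
        have "v \<bullet> f a b = \<kappa> c \<bullet> f a b0"
          unfolding v_def T(6)[OF b that, symmetric] by (rule T(3)[OF b])
        also have "\<dots> = 0" using W that by (simp add: W_iff)
        finally show ?thesis by (simp add: f_def)
      qed
      moreover have "v \<bullet> v = 1"
        using T(3)[OF b, of "\<kappa> c" "\<kappa> c"] \<kappa>(4)[of c] c by (simp add: v_def norm_eq_1[symmetric])
      moreover have "j b \<bullet> j b = 1" using jg(2)[of b] b by (simp add: norm_eq_1[symmetric])
      ultimately have "k (b, c) \<in> focal_set" by (simp add: focal_set_iff pm)
      moreover have \<pi>: "\<pi> (k (b, c)) = b" by (simp add: \<pi>_def pm jg)
      moreover have "h (k (b, c)) = c" by (simp add: h_def \<pi> pm v_def T(2)[OF b] \<kappa>(6))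
      ultimately show ?thesis by blast
    qed
    ultimately show ?thesis using U by blast
  qed
  show ?thesis
  proof (rule fibers_overI[OF smooth_submanifold_sphere smooth_submanifold_sphere _ _ sm _ triv])
    show "DIM('b) - 1 + (DIM('c) - 1) \<le> DIM('a)" using dims by simp
  qed (use \<pi>_sphere in auto)
qed

end

section \<open>From Clifford matrices to the two bundles\<close>

text \<open>The Clifford relation gives involutions for equal indices and anticommutation for
  distinct ones; \<open>A\<close> omits \<open>i\<close>, so \<open>P i\<close> anticommutes with
  all the others.\<close>

lemma clifford_anticommuting_involutions:
  fixes P :: "nat \<Rightarrow> real^'n^'n"
  assumes "symmetric_clifford_system m P" "i \<le> m" "A \<subseteq> {..m} - {i}" "A \<noteq> {}"
  shows "anticommuting_involutions ((*v) (P i)) A (\<lambda>a. (*v) (P a))"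
proof -
  have sym: "(P a *v x) \<bullet> y = x \<bullet> (P a *v y)" if "a \<le> m" for a x y
    using assms(1) that dot_lmul_matrix[of x "P a" y]
    by (metis symmetric_clifford_system_def transpose_matrix_vector)
  have rel: "P a *v (P b *v x) + P b *v (P a *v x) = (2 * of_bool (a = b)) *\<^sub>R x"
    if "a \<le> m" "b \<le> m" for a b x
  proof -
    have "P a ** P b + P b ** P a = (2 * of_bool (a = b)) *\<^sub>R mat 1"
      using assms(1) that by (simp add: symmetric_clifford_system_def)
    then have "(P a ** P b + P b ** P a) *v x = ((2 * of_bool (a = b)) *\<^sub>R mat 1) *v x" by simp
    then show ?thesis
      by (simp add: matrix_vector_mult_add_rdistrib matrix_vector_mul_assoc scaleR_matrix_vector_assoc[symmetric])
  qed
  have inv: "P a *v (P a *v x) = x" if "a \<le> m" for a x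
    using rel[OF that that, of x] by (simp add: scaleR_2[symmetric])
  have anti: "P a *v (P b *v x) = - (P b *v (P a *v x))" if "a \<le> m" "b \<le> m" "a \<noteq> b" for a b x
    using rel[OF that(1,2), of x] that(3) by (simp add: eq_neg_iff_add_eq_0)
  have A: "a \<le> m" "a \<noteq> i" if "a \<in> A" for a using assms(3) that by auto
  have "finite A" using assms(3) by (rule finite_subset) simp
  then show ?thesis
  proof (rule anticommuting_involutions.intro)
    show "P i *v (P a *v x) = - (P a *v (P i *v x))" if "a \<in> A" for a x
      using A[OF that] assms(2) by (intro anti) auto
    show "P a *v (P b *v x) = - (P b *v (P a *v x))" if "a \<in> A" "b \<in> A" "a \<noteq> b" for a b x
      using that by (intro anti A)
  qed (simp_all add: assms(2,4) A sym inv)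
qed

text \<open>Index types carry the dimensions: the unit sphere of \<open>real^'l\<close> is the
  (l-1)-sphere, and the cardinalities of \<open>'f\<close> and \<open>'g\<close> make the fibres
  spheres of dimension l-i-2 and i-1.\<close>

theorem corollary1p1:
  fixes P :: "nat \<Rightarrow> real^'n^'n" and l m :: nat
  assumes "CARD('n) = 2 * l" and "CARD('l) = l"
    and "symmetric_clifford_system m P"
    and "m > 0" and "l > m + 1"
  shows "(\<forall>i. i \<le> m - 1 \<longrightarrow> CARD('f) = l - i - 1 \<longrightarrow>
            fibers_over (clifford_M P (i + 1)) (sphere 0 1 :: (real^'l) set) (sphere 0 1 :: (real^'f) set))
       \<and> (\<forall>i. 2 \<le> i \<and> i \<le> m \<longrightarrow> CARD('g) = i \<longrightarrow>
            fibers_over (clifford_N P (i - 1)) (sphere 0 1 :: (real^'l) set) (sphere 0 1 :: (real^'g) set))"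
proof (intro conjI allI impI)
  fix i assume i: "i \<le> m - 1" and f: "CARD('f) = l - i - 1"
  interpret anticommuting_involutions "(*v) (P 0)" "{1..i + 1}" "\<lambda>a. (*v) (P a)"
    by (rule clifford_anticommuting_involutions[OF assms(3)]) (use i assms(4) in auto)
  have split: "(\<forall>a\<le>i + 1. Z a) \<longleftrightarrow> Z 0 \<and> (\<forall>a\<in>{1..i + 1}. Z a)" for Z
    by (metis One_nat_def Suc_leI atLeastAtMost_iff le0 neq0_conv)
  have "clifford_M P (i + 1) = focal_set"
    unfolding clifford_M_def focal_set_def split by (simp add: norm_eq_1)
  moreover have "fibers_over focal_set (sphere 0 1 :: (real^'l) set) (sphere 0 1 :: (real^'f) set)"
    \<comment> \<open>Here \<open>card A\<close> is \<open>i + 1\<close>, and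
      \<open>l > m + 1\<close> keeps the subtraction \<open>l - i - 1\<close> from being
      truncated.\<close>
    by (rule focal_set_fibers_over) (use assms i f in auto)
  ultimately show
    "fibers_over (clifford_M P (i + 1)) (sphere 0 1 :: (real^'l) set) (sphere 0 1 :: (real^'f) set)"
    by simp
next
  fix i assume i: "2 \<le> i \<and> i \<le> m" and g: "CARD('g) = i"
  \<comment> \<open>The set uses the \<open>i\<close> matrices up to index \<open>i - 1\<close>;
    \<open>P i\<close> is the next one, present because \<open>i \<le> m\<close>.\<close>
  interpret anticommuting_involutions "(*v) (P i)" "{..i - 1}" "\<lambda>a. (*v) (P a)"
    by (rule clifford_anticommuting_involutions[OF assms(3)]) (use i in auto)
  have "clifford_N P (i - 1) = spherical_set"
    unfolding clifford_N_def spherical_set_def by (simp add: norm_eq_1)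
  moreover have "fibers_over spherical_set (sphere 0 1 :: (real^'l) set) (sphere 0 1 :: (real^'g) set)"
    by (rule spherical_set_fibers_over) (use assms i g in auto)
  ultimately show
    "fibers_over (clifford_N P (i - 1)) (sphere 0 1 :: (real^'l) set) (sphere 0 1 :: (real^'g) set)"
    by simp
qed

end
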